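(* Let $f:\mathbb R\to\mathbb R$ be a smooth function such that $f$ and $f_u$ are linearly independent over $\mathbb R$, let $k\ge0$, and let $\Phi\in\mathcal C_{(k)}$ with coefficients $\rho,A,B^{ij},D^{ij}$ as in the definition of normal form in the context, where $\rho$ is normalized by $e_0\lrcorner\rho=0$. Then $\Phi$ is of the form $$\Phi=\eta_0\wedge\rho+A\psi+\sum_{1\le i<j\le k}\left(B^{ij}\eta_i\wedge\eta_j+\overline{B^{ij}}\,\bar\eta_i\wedge\bar\eta_j\right).$$ The one-form $\rho$ and the functions $B^{ij}$ are determined by $A$ via $$\rho=-\tfrac12J\,dA,\qquad B^{ij}=\sqrt{-1}\sum_{m=0}^{k-j-i+1}(-1)^{m-i+1}\binom{m+i-1}{i-1}(e_{-1})^mA_{u_{m+j+i-1}}\quad(1\le i<j\le k).$$ The function $A$ on $M^{(k)}$ satisfies $A_u=0$, $A_{u_i\bar u_j}=0$ for all $i,j$, and $$e_{\overline{-1}}e_{-1}A+f_uA=0.$$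
   Context: The underlying PDE is $u_{z\bar z}=-f(u)$ for $u:\mathbb C\to\mathbb R$. Subscripts such as $f_u$, $A_{u_i}$ denote partial derivatives; bars denote complex conjugation. For $k\ge 0$ let $M^{(k)}=\mathbb C^{k+2}\times\mathbb R$ with complex coordinates $z,u_0,\dots,u_k$ and real coordinate $u$. Let $M^{(\infty)}$ be the inverse limit of the projections $M^{(k+1)}\to M^{(k)}$ forgetting $u_{k+1}$; smooth functions and differential forms on $M^{(\infty)}$ are by definition pullbacks of such objects from some $M^{(k)}$, and are identified with them. Put $T^0=f(u)$, $T^{i+1}=\sum_{j=0}^{i}\binom ij u_{i-j}\,T^j_u$, and $\zeta=dz$, $\eta_0=du-u_0\zeta-\bar u_0\bar\zeta$, $\omega_{i+1}=du_i+T^i\bar\zeta$, $\eta_{i+1}=\omega_{i+1}-u_{i+1}\zeta$ ($i\ge0$), $\psi=\operatorname{Im}(\zeta\wedge\omega_1)$. Let $\mathcal I^{(\infty)}$ be the differential ideal on $M^{(\infty)}$ generated by $\eta_0,\eta_i,\bar\eta_i$ ($i\ge1$). The vector fields dual to the coframe $\zeta,\bar\zeta,\eta_0,\eta_i,\bar\eta_i$ are $e_{-1}=\partial_z+u_0\partial_u+\sum_{i\ge0}u_{i+1}\partial_{u_i}-\sum_{i\ge0}\overline{T^i}\,\partial_{\bar u_i}$, $e_0=\partial_u$, $e_i=\partial_{u_{i-1}}$ ($i\ge1$), and their conjugates; $e_{\overline{-1}}=\overline{e_{-1}}$. Let $J$ be the complex-linear operator on $1$-forms acting as $\sqrt{-1}$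 on $\zeta,\eta_1,\eta_2,\dots$, as $-\sqrt{-1}$ on $\bar\zeta,\bar\eta_1,\bar\eta_2,\dots$, and as the identity on $\eta_0$. $\mathcal C$ (representatives of differentiated conservation laws in normal form) is the space of closed real $2$-forms $\Phi\in\mathcal I^{(\infty)}$ on $M^{(\infty)}$ of the form $\Phi=\eta_0\wedge\rho+A\psi+\sum_{1\le i<j\le k}(B^{ij}\eta_i\wedge\eta_j+\overline{B^{ij}}\bar\eta_i\wedge\bar\eta_j)+\sum_{1\le i\le j\le k}(D^{ij}\eta_i\wedge\bar\eta_j+\overline{D^{ij}}\bar\eta_i\wedge\eta_j)$ for some $k$, some $1$-form $\rho$, and some functions $A,B^{ij},D^{ij}$ with $A$ real. $\mathcal C_{(k)}\subset\mathcal C$ is the subspace of those elements defined on $M^{(k)}$ (so the sums run over indices at most $k$). $A$ is called the generating function of $\Phi$. Empty sums are $0$. *)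

theory Defs
  imports "HOL-Analysis.Analysis" "HOL-Library.Function_Algebras"
begin

section \<open>Functions on the spaces \<open>M\<^sup>(\<^sup>k\<^sup>)\<close> and their inverse limit\<close>

text \<open>
  A point of the inverse limit is \<open>(z, (u\<^sub>0, u\<^sub>1, \<dots>), u)\<close>. Functions and forms on
  \<open>M\<^sup>(\<^sup>k\<^sup>)\<close> are represented by their pullbacks, i.e. by functions and forms on the
  inverse limit that only involve \<open>z, u, u\<^sub>0, \<dots>, u\<^sub>k\<close>.
\<close>

type_synonym point = "complex \<times> (nat \<Rightarrow> complex) \<times> real"

fun uj :: "nat \<Rightarrow> point \<Rightarrow> complex" where
  "uj i (z, w, u) = w i"

fun uval :: "point \<Rightarrow> real" where
  "uval (z, w, u) = u"

fun same_upto :: "nat \<Rightarrow> point \<Rightarrow> point \<Rightarrow> bool" where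
  "same_upto k (z, w, u) (z', w', u') \<longleftrightarrow> z = z' \<and> u = u' \<and> (\<forall>i\<le>k. w i = w' i)"

datatype rcoord = ReZ | ImZ | RealU | ReUi nat | ImUi nat

fun move :: "rcoord \<Rightarrow> real \<Rightarrow> point \<Rightarrow> point" where
  "move ReZ t (z, w, u) = (z + of_real t, w, u)"
| "move ImZ t (z, w, u) = (z + \<i> * of_real t, w, u)"
| "move RealU t (z, w, u) = (z, w, u + t)"
| "move (ReUi i) t (z, w, u) = (z, w(i := w i + of_real t), u)"
| "move (ImUi i) t (z, w, u) = (z, w(i := w i + \<i> * of_real t), u)"

definition rpartial :: "rcoord \<Rightarrow> (point \<Rightarrow> complex) \<Rightarrow> point \<Rightarrow> complex" where
  "rpartial c F p = vector_derivative (\<lambda>t. F (move c t p)) (at 0)"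

text \<open>
  Smoothness means that all iterated real partial derivatives exist and are continuous. For
  functions of finitely many coordinates, continuity in the product topology is the usual continuity.
\<close>

definition smooth_fun :: "nat \<Rightarrow> (point \<Rightarrow> complex) \<Rightarrow> bool" where
  "smooth_fun k F \<longleftrightarrow>
     (\<forall>p q. same_upto k p q \<longrightarrow> F p = F q) \<and>
     (\<forall>cs. continuous_on UNIV (foldr rpartial cs F) \<and>
           (\<forall>c p. (\<lambda>t. foldr rpartial cs F (move c t p)) differentiable (at 0)))"

definition smooth_fun_inf :: "(point \<Rightarrow> complex) \<Rightarrow> bool" where
  "smooth_fun_inf F \<longleftrightarrow> (\<exists>k. smooth_fun k F)"

definition smooth_real :: "(real \<Rightarrow> real) \<Rightarrow> bool" where
  "smooth_real f \<longleftrightarrow> (\<forall>n. (deriv ^^ n) f differentiable_on UNIV)"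

text \<open>
  The complex coordinates \<open>z, u, u\<^sub>i\<close> and the conjugates of \<open>z, u\<^sub>i\<close> index the coordinate frame of the
  complexified tangent bundle; the associated partial derivatives are the Wirtinger derivatives.
\<close>

datatype coord = Z | Zbar | U | Ui nat | Uibar nat

fun bar :: "coord \<Rightarrow> coord" where
  "bar Z = Zbar" | "bar Zbar = Z" | "bar U = U" | "bar (Ui i) = Uibar i" | "bar (Uibar i) = Ui i"

definition coords_upto :: "nat \<Rightarrow> coord set" where
  "coords_upto k = {Z, Zbar, U} \<union> Ui ` {..k} \<union> Uibar ` {..k}"

fun partial :: "coord \<Rightarrow> (point \<Rightarrow> complex) \<Rightarrow> point \<Rightarrow> complex" where
  "partial Z F p = (rpartial ReZ F p - \<i> * rpartial ImZ F p) / 2"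
| "partial Zbar F p = (rpartial ReZ F p + \<i> * rpartial ImZ F p) / 2"
| "partial U F p = rpartial RealU F p"
| "partial (Ui i) F p = (rpartial (ReUi i) F p - \<i> * rpartial (ImUi i) F p) / 2"
| "partial (Uibar i) F p = (rpartial (ReUi i) F p + \<i> * rpartial (ImUi i) F p) / 2"


section \<open>Complex-valued differential forms\<close>

text \<open>
  A form \<open>\<alpha>\<close> is given by its coefficients \<open>\<alpha> [a\<^sub>1, \<dots>, a\<^sub>n] = \<alpha>(\<partial>\<^sub>a\<^sub>1, \<dots>, \<partial>\<^sub>a\<^sub>n)\<close> in the complex
  coordinate frame, so an \<open>n\<close>-form is supported on lists of length \<open>n\<close>. Addition and finite sums of
  forms are the pointwise ones from Function_Algebras.
\<close>

type_synonym form = "coord list \<Rightarrow> point \<Rightarrow> complex"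

definition form_on :: "nat \<Rightarrow> form \<Rightarrow> bool" where
  "form_on k \<alpha> \<longleftrightarrow>
     (\<forall>as a b bs p. \<alpha> (as @ a # b # bs) p = - \<alpha> (as @ b # a # bs) p) \<and>
     (\<forall>as. smooth_fun k (\<alpha> as)) \<and>
     (\<forall>as p. \<not> set as \<subseteq> coords_upto k \<longrightarrow> \<alpha> as p = 0)"

definition form_inf :: "form \<Rightarrow> bool" where
  "form_inf \<alpha> \<longleftrightarrow> (\<exists>k. form_on k \<alpha>)"

definition has_degree :: "nat \<Rightarrow> form \<Rightarrow> bool" where
  "has_degree n \<alpha> \<longleftrightarrow> (\<forall>as p. length as \<noteq> n \<longrightarrow> \<alpha> as p = 0)"

definition fun_form :: "(point \<Rightarrow> complex) \<Rightarrow> form" where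
  "fun_form F = (\<lambda>as p. if as = [] then F p else 0)"

definition dcoord :: "coord \<Rightarrow> form" where
  "dcoord a = (\<lambda>as p. if as = [a] then 1 else 0)"

definition smult_form :: "(point \<Rightarrow> complex) \<Rightarrow> form \<Rightarrow> form" (infixr \<open>\<cdot>\<close> 75) where
  "F \<cdot> \<alpha> = (\<lambda>as p. F p * \<alpha> as p)"

definition cnj_form :: "form \<Rightarrow> form" where
  "cnj_form \<alpha> = (\<lambda>as p. cnj (\<alpha> (map bar as) p))"

definition Im_form :: "form \<Rightarrow> form" where
  "Im_form \<alpha> = (\<lambda>p. 1 / (2 * \<i>)) \<cdot> (\<alpha> - cnj_form \<alpha>)"

text \<open>
  The wedge product is a signed sum over shuffles: \<open>S\<close> is the set of argument positions
  fed to \<open>\<alpha>\<close>. For 1-forms, \<open>(\<alpha> \<and> \<beta>)(X, Y) = \<alpha>(X) \<beta>(Y) - \<alpha>(Y) \<beta>(X)\<close>.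
\<close>

definition wedge :: "form \<Rightarrow> form \<Rightarrow> form" (infixl \<open>\<and>\<^sub>f\<close> 80) where
  "\<alpha> \<and>\<^sub>f \<beta> = (\<lambda>as p. \<Sum>S\<in>Pow {..<length as}.
     (-1) ^ card {(i, j). i \<in> S \<and> j \<in> {..<length as} - S \<and> j < i} *
     \<alpha> (nths as S) p * \<beta> (nths as (- S)) p)"

definition ext_d :: "form \<Rightarrow> form" where
  "ext_d \<alpha> = (\<lambda>as p. \<Sum>i<length as.
     (-1) ^ i * partial (as ! i) (\<alpha> (take i as @ drop (Suc i) as)) p)"

text \<open>
  Complex vector fields on the inverse limit, by components. They may have infinitely many nonzero
  components, but act on functions and forms on some \<open>M\<^sup>(\<^sup>k\<^sup>)\<close> through finite sums; the sums
  below are restricted to the indices that contribute.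
\<close>

type_synonym vfield = "coord \<Rightarrow> point \<Rightarrow> complex"

definition cnj_vf :: "vfield \<Rightarrow> vfield" where
  "cnj_vf X = (\<lambda>a p. cnj (X (bar a) p))"

definition apply_vf :: "vfield \<Rightarrow> (point \<Rightarrow> complex) \<Rightarrow> point \<Rightarrow> complex" where
  "apply_vf X F p = (\<Sum>a | partial a F p \<noteq> 0. X a p * partial a F p)"

definition interior_prod :: "vfield \<Rightarrow> form \<Rightarrow> form" where
  "interior_prod X \<alpha> = (\<lambda>as p. \<Sum>a | \<alpha> (a # as) p \<noteq> 0. X a p * \<alpha> (a # as) p)"


section \<open>The structure attached to the equation\<close>

fun T :: "(real \<Rightarrow> real) \<Rightarrow> nat \<Rightarrow> point \<Rightarrow> complex" where
  "T f 0 = (\<lambda>p. of_real (f (uval p)))"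
| "T f (Suc i) = (\<lambda>p. \<Sum>j\<le>i. of_nat (i choose j) * uj (i - j) p * partial U (T f j) p)"

definition zeta :: form where
  "zeta = dcoord Z"

text \<open>\<open>omega f i\<close> is only meant for \<open>i \<ge> 1\<close>.\<close>

definition omega :: "(real \<Rightarrow> real) \<Rightarrow> nat \<Rightarrow> form" where
  "omega f i = dcoord (Ui (i - 1)) + T f (i - 1) \<cdot> cnj_form zeta"

definition eta :: "(real \<Rightarrow> real) \<Rightarrow> nat \<Rightarrow> form" where
  "eta f i = (if i = 0 then dcoord U - uj 0 \<cdot> zeta - (\<lambda>p. cnj (uj 0 p)) \<cdot> cnj_form zeta
              else omega f i - uj i \<cdot> zeta)"

definition psi :: "(real \<Rightarrow> real) \<Rightarrow> form" where
  "psi f = Im_form (zeta \<and>\<^sub>f omega f 1)"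

fun e_m1 :: "(real \<Rightarrow> real) \<Rightarrow> vfield" where
  "e_m1 f Z = (\<lambda>p. 1)"
| "e_m1 f Zbar = (\<lambda>p. 0)"
| "e_m1 f U = uj 0"
| "e_m1 f (Ui i) = uj (Suc i)"
| "e_m1 f (Uibar i) = (\<lambda>p. - cnj (T f i p))"

definition coord_vf :: "coord \<Rightarrow> vfield" where
  "coord_vf a = (\<lambda>b p. if b = a then 1 else 0)"

text \<open>
  The coframe \<open>\<zeta>, \<eta>\<^sub>0, \<eta>\<^sub>i\<close> with conjugates and its dual frame are both indexed by the corresponding
  coordinates: \<open>\<eta>\<^sub>i\<^sub>+\<^sub>1\<close> and \<open>e\<^sub>i\<^sub>+\<^sub>1 = \<partial>/\<partial>u\<^sub>i\<close> have index \<open>Ui i\<close>.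
\<close>

fun frame :: "(real \<Rightarrow> real) \<Rightarrow> coord \<Rightarrow> vfield" where
  "frame f Z = e_m1 f"
| "frame f Zbar = cnj_vf (e_m1 f)"
| "frame f U = coord_vf U"
| "frame f (Ui i) = coord_vf (Ui i)"
| "frame f (Uibar i) = coord_vf (Uibar i)"

fun coframe :: "(real \<Rightarrow> real) \<Rightarrow> coord \<Rightarrow> form" where
  "coframe f Z = zeta"
| "coframe f Zbar = cnj_form zeta"
| "coframe f U = eta f 0"
| "coframe f (Ui i) = eta f (Suc i)"
| "coframe f (Uibar i) = cnj_form (eta f (Suc i))"

fun J_eigenvalue :: "coord \<Rightarrow> complex" where
  "J_eigenvalue Z = \<i>"
| "J_eigenvalue Zbar = - \<i>"
| "J_eigenvalue U = 1"
| "J_eigenvalue (Ui i) = \<i>"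
| "J_eigenvalue (Uibar i) = - \<i>"

text \<open>
  The operator \<open>J\<close> on 1-forms, obtained by expanding \<open>\<alpha>\<close> in the coframe; the coefficient of
  \<open>coframe f a\<close> is \<open>\<alpha>(frame f a)\<close>, and only finitely many of them are nonzero.
\<close>

definition J :: "(real \<Rightarrow> real) \<Rightarrow> form \<Rightarrow> form" where
  "J f \<alpha> = (\<lambda>as p. \<Sum>a | interior_prod (frame f a) \<alpha> [] p \<noteq> 0.
     J_eigenvalue a * interior_prod (frame f a) \<alpha> [] p * coframe f a as p)"

text \<open>The differential ideal in the algebra of all (possibly inhomogeneous) complex-valued forms.\<close>

inductive_set diff_ideal :: "(real \<Rightarrow> real) \<Rightarrow> form set" for f where
  eta: "eta f i \<in> diff_ideal f"
| cnj_eta: "i \<ge> 1 \<Longrightarrow> cnj_form (eta f i) \<in> diff_ideal f"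
| add: "\<alpha> \<in> diff_ideal f \<Longrightarrow> \<beta> \<in> diff_ideal f \<Longrightarrow> \<alpha> + \<beta> \<in> diff_ideal f"
| wedge_left: "form_inf \<beta> \<Longrightarrow> \<alpha> \<in> diff_ideal f \<Longrightarrow> \<beta> \<and>\<^sub>f \<alpha> \<in> diff_ideal f"
| wedge_right: "form_inf \<beta> \<Longrightarrow> \<alpha> \<in> diff_ideal f \<Longrightarrow> \<alpha> \<and>\<^sub>f \<beta> \<in> diff_ideal f"
| ext_d: "\<alpha> \<in> diff_ideal f \<Longrightarrow> ext_d \<alpha> \<in> diff_ideal f"


section \<open>Differentiated conservation laws in normal form\<close>

definition B_part :: "(real \<Rightarrow> real) \<Rightarrow> nat \<Rightarrow> (nat \<Rightarrow> nat \<Rightarrow> point \<Rightarrow> complex) \<Rightarrow> form" where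
  "B_part f k B = (\<Sum>(i, j)\<in>{(i, j). 1 \<le> i \<and> i < j \<and> j \<le> k}.
      B i j \<cdot> (eta f i \<and>\<^sub>f eta f j)
      + (\<lambda>p. cnj (B i j p)) \<cdot> (cnj_form (eta f i) \<and>\<^sub>f cnj_form (eta f j)))"

definition D_part :: "(real \<Rightarrow> real) \<Rightarrow> nat \<Rightarrow> (nat \<Rightarrow> nat \<Rightarrow> point \<Rightarrow> complex) \<Rightarrow> form" where
  "D_part f k D = (\<Sum>(i, j)\<in>{(i, j). 1 \<le> i \<and> i \<le> j \<and> j \<le> k}.
      D i j \<cdot> (eta f i \<and>\<^sub>f cnj_form (eta f j))
      + (\<lambda>p. cnj (D i j p)) \<cdot> (cnj_form (eta f i) \<and>\<^sub>f eta f j))"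

definition normal_form :: "(real \<Rightarrow> real) \<Rightarrow> nat \<Rightarrow> form \<Rightarrow> form \<Rightarrow> (point \<Rightarrow> complex) \<Rightarrow>
    (nat \<Rightarrow> nat \<Rightarrow> point \<Rightarrow> complex) \<Rightarrow> (nat \<Rightarrow> nat \<Rightarrow> point \<Rightarrow> complex) \<Rightarrow> bool" where
  "normal_form f k \<Phi> \<rho> A B D \<longleftrightarrow>
     form_inf \<rho> \<and> has_degree 1 \<rho> \<and>
     smooth_fun_inf A \<and> (\<forall>p. A p \<in> \<real>) \<and>
     (\<forall>i j. 1 \<le> i \<and> i < j \<and> j \<le> k \<longrightarrow> smooth_fun_inf (B i j)) \<and>
     (\<forall>i j. 1 \<le> i \<and> i \<le> j \<and> j \<le> k \<longrightarrow> smooth_fun_inf (D i j)) \<and>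
     \<Phi> = eta f 0 \<and>\<^sub>f \<rho> + A \<cdot> psi f + B_part f k B + D_part f k D"

definition cons_laws :: "(real \<Rightarrow> real) \<Rightarrow> form set" where
  "cons_laws f = {\<Phi>. form_inf \<Phi> \<and> has_degree 2 \<Phi> \<and> cnj_form \<Phi> = \<Phi> \<and> ext_d \<Phi> = 0 \<and>
     \<Phi> \<in> diff_ideal f \<and> (\<exists>k \<rho> A B D. normal_form f k \<Phi> \<rho> A B D)}"

definition cons_laws_on :: "(real \<Rightarrow> real) \<Rightarrow> nat \<Rightarrow> form set" where
  "cons_laws_on f k = {\<Phi> \<in> cons_laws f. form_on k \<Phi>}"

end

theory Submission
  imports Defs
begin

text \<open>
  Write \<open>E = e\<^sub>-\<^sub>1\<close> and evaluate \<open>d\<Phi> = 0\<close> on triples of frame fields, using \<open>[E, e\<^sub>1] = - e\<^sub>0\<close>,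
  \<open>[E, e\<^sub>i\<^sub>+\<^sub>1] = - e\<^sub>i\<close> and \<open>[E, E'] = 0\<close>, where a prime denotes conjugation. Since \<open>\<Phi>\<close> involves no
  \<open>\<eta>\<^sub>i\<close> with \<open>i > k\<close>, the triples \<open>(E, e\<^sub>i, e'\<^sub>j)\<close> with \<open>i \<ge> 2\<close> make the mixed coefficients vanish by
  descending induction on \<open>i\<close>, and \<open>i = 1\<close> then yields \<open>\<rho>(e'\<^sub>j)\<close>. The triples \<open>(E, E', e\<^sub>1)\<close> and
  \<open>(E, E', e'\<^sub>1)\<close> give \<open>\<rho>(E')\<close> and \<open>\<rho>(E)\<close>, \<open>(E, e\<^sub>0, e\<^sub>1)\<close> gives \<open>A\<^sub>u = 0\<close>, \<open>(e\<^sub>0, e\<^sub>i, e'\<^sub>j)\<close> gives the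
  vanishing of the mixed second derivatives, and \<open>(E, E', e\<^sub>0)\<close> gives the equation for \<open>A\<close>. Finally
  \<open>(E, e\<^sub>i, e\<^sub>j)\<close> is a recursion, descending in \<open>j\<close>, for the coefficients \<open>B\<^sup>i\<^sup>j\<close>; it is solved by Pascal's
  rule.
\<close>

text \<open>The obstacle is that E has infinitely many components. The identities are therefore
  taken on \<open>coords_upto N\<close> with N large, where product rule, commutators and closedness
  are exact and the remaining coordinates are parameters. Only [E, E'] = 0 suffers: it fails in
  components of index N > k, which neither \<Phi> nor A sees. E and E' lie in the kernel of every
  \<eta>_i and its conjugate, so \<Phi>(E, Y) contains only \<rho> and A; B and D enter through one
  differentiated term and through brackets. The descents can start because du_k is not part of
  \<eta>_1, ..., \<eta>_k: \<Phi>(e_(k+1), .) vanishes on all e_j and e'_j with j \<ge> 1. The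
  constants come from h = 1/(2 \<i>) in \<psi>: on 1-forms, - J / 2 has eigenvalue h on the
  holomorphic part and - h on the conjugate part, and the factor \<i> in front of B is - 2 h. In the
  identities for A_u, for the mixed second derivatives and for the equation of A, two equal
  contributions add up to 2 h times the desired expression instead of cancelling.\<close>

subsection \<open>Symmetry of second derivatives\<close>

text \<open>The second difference of g over the square with corner 0 and side h is evaluated by the
  mean value theorem in both orders, giving h^2 gst and h^2 gts at points near the origin. Only
  one-variable derivatives are used because \<open>smooth_fun\<close> is built from these
  alone.\<close>

lemma mixed_derivatives_real:
  fixes g :: "real \<Rightarrow> real \<Rightarrow> real"
  assumes gs: "\<And>s t. ((\<lambda>s. g s t) has_real_derivative gs s t) (at s)"
    and gt: "\<And>s t. ((\<lambda>t. g s t) has_real_derivative gt s t) (at t)"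
    and gst: "\<And>s t. ((\<lambda>t. gs s t) has_real_derivative gst s t) (at t)"
    and gts: "\<And>s t. ((\<lambda>s. gt s t) has_real_derivative gts s t) (at s)"
    and cst: "isCont (\<lambda>(s, t). gst s t) (0, 0)"
    and cts: "isCont (\<lambda>(s, t). gts s t) (0, 0)"
  shows "gst 0 0 = gts 0 0"
proof (rule ccontr)
  assume "gst 0 0 \<noteq> gts 0 0"
  define e where "e = \<bar>gst 0 0 - gts 0 0\<bar> / 2"
  have e: "e > 0" using \<open>gst 0 0 \<noteq> gts 0 0\<close> by (simp add: e_def)
  obtain d1 where d1: "d1 > 0" "\<And>s t. dist (s, t) (0::real, 0::real) < d1 \<Longrightarrow> \<bar>gst s t - gst 0 0\<bar> < e"
    using cst e by (fastforce simp: continuous_at_eps_delta dist_real_def)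
  obtain d2 where d2: "d2 > 0" "\<And>s t. dist (s, t) (0::real, 0::real) < d2 \<Longrightarrow> \<bar>gts s t - gts 0 0\<bar> < e"
    using cts e by (fastforce simp: continuous_at_eps_delta dist_real_def)
  \<comment> \<open>By the triangle inequality a point of the square of side h has distance below 2
    h from the origin; hence the division by 2.\<close>
  define h where "h = min d1 d2 / 2"
  have h: "h > 0" "2 * h \<le> d1" "2 * h \<le> d2" using d1 d2 by (auto simp: h_def)
  have near: "dist (s, t) (0::real, 0::real) < 2 * h" if "0 < s" "s < h" "0 < t" "t < h" for s t
    using that dist_triangle[of "(s, t)" "(0, 0)" "(s, 0::real)"]
    by (simp add: dist_Pair_Pair)
  have "\<exists>z. 0 < z \<and> z < h \<and> (g h h - g h 0) - (g 0 h - g 0 0) = (h - 0) * (gs z h - gs z 0)"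
    using h by (intro MVT2[of 0 h "\<lambda>s. g s h - g s 0"]) (auto intro!: derivative_eq_intros gs)
  then obtain x where x: "0 < x" "x < h" "(g h h - g h 0) - (g 0 h - g 0 0) = h * (gs x h - gs x 0)"
    by auto
  have "\<exists>z. 0 < z \<and> z < h \<and> gs x h - gs x 0 = (h - 0) * gst x z"
    using h by (intro MVT2) (auto intro!: gst)
  then obtain y where y: "0 < y" "y < h" "gs x h - gs x 0 = h * gst x y" by auto
  have "\<exists>z. 0 < z \<and> z < h \<and> (g h h - g 0 h) - (g h 0 - g 0 0) = (h - 0) * (gt h z - gt 0 z)"
    using h by (intro MVT2[of 0 h "\<lambda>t. g h t - g 0 t"]) (auto intro!: derivative_eq_intros gt)
  then obtain v where v: "0 < v" "v < h" "(g h h - g 0 h) - (g h 0 - g 0 0) = h * (gt h v - gt 0 v)"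
    by auto
  have "\<exists>z. 0 < z \<and> z < h \<and> gt h v - gt 0 v = (h - 0) * gts z v"
    using h by (intro MVT2) (auto intro!: gts)
  then obtain w where w: "0 < w" "w < h" "gt h v - gt 0 v = h * gts w v" by auto
  have "h * (h * gst x y) = h * (h * gts w v)" using x(3) y(3) v(3) w(3) by (simp add: algebra_simps)
  hence "gst x y = gts w v" using h by simp
  moreover have "\<bar>gst x y - gst 0 0\<bar> < e" using near[of x y] x y h by (intro d1) simp
  moreover have "\<bar>gts w v - gts 0 0\<bar> < e" using near[of w v] v w h by (intro d2) simp
  ultimately have "\<bar>gst 0 0 - gts 0 0\<bar> < 2 * e" by linarith
  then show False by (simp add: e_def)
qed

text \<open>Real and imaginary parts are treated separately since the mean value theorem fails for
  complex values.\<close>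

lemma mixed_derivatives:
  fixes g :: "real \<Rightarrow> real \<Rightarrow> complex"
  assumes gs: "\<And>s t. ((\<lambda>s. g s t) has_vector_derivative gs s t) (at s)"
    and gt: "\<And>s t. ((\<lambda>t. g s t) has_vector_derivative gt s t) (at t)"
    and gst: "\<And>s t. ((\<lambda>t. gs s t) has_vector_derivative gst s t) (at t)"
    and gts: "\<And>s t. ((\<lambda>s. gt s t) has_vector_derivative gts s t) (at s)"
    and cst: "isCont (\<lambda>(s, t). gst s t) (0, 0)"
    and cts: "isCont (\<lambda>(s, t). gts s t) (0, 0)"
  shows "gst 0 0 = gts 0 0"
proof (rule complex_eqI)
  have Re: "((\<lambda>s. Re (F s)) has_real_derivative Re D) (at x)"
    and Im: "((\<lambda>s. Im (F s)) has_real_derivative Im D) (at x)"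
    if "(F has_vector_derivative D) (at x)" for F D x
    using bounded_linear.has_vector_derivative[OF bounded_linear_Re that]
      bounded_linear.has_vector_derivative[OF bounded_linear_Im that]
    by (simp_all add: has_real_derivative_iff_has_vector_derivative)
  show "Re (gst 0 0) = Re (gts 0 0)"
    by (rule mixed_derivatives_real[where g = "\<lambda>s t. Re (g s t)" and gs = "\<lambda>s t. Re (gs s t)" and gt = "\<lambda>s t. Re (gt s t)"])
      (use assms in \<open>auto intro!: Re simp: case_prod_unfold intro!: continuous_intros\<close>)
  show "Im (gst 0 0) = Im (gts 0 0)"
    by (rule mixed_derivatives_real[where g = "\<lambda>s t. Im (g s t)" and gs = "\<lambda>s t. Im (gs s t)" and gt = "\<lambda>s t. Im (gt s t)"])
      (use assms in \<open>auto intro!: Im simp: case_prod_unfold intro!: continuous_intros\<close>)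
qed

subsection \<open>Real partial derivatives\<close>

lemma move_0 [simp]: "move c 0 p = p"
  by (cases c; cases p) auto

lemma move_move: "move c s (move c t p) = move c (s + t) p"
  by (cases c; cases p) (auto simp: algebra_simps)

lemma move_commute: "move c s (move d t p) = move d t (move c s p)"
  by (cases c; cases d; cases p) (auto simp: algebra_simps fun_upd_def fun_eq_iff)

lemma same_upto_move: "same_upto k p q \<Longrightarrow> same_upto k (move c t p) (move c t q)"
  by (cases c; cases p; cases q) auto

lemma same_upto_mono: "same_upto n p q \<Longrightarrow> m \<le> n \<Longrightarrow> same_upto m p q"
  by (cases p; cases q) auto

lemma same_upto_refl [simp]: "same_upto n p p"
  by (cases p) auto

text \<open>Supplies the joint continuity demanded by the symmetry of second derivatives. In the
  product topology it is enough to check each coordinate.\<close>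

lemma continuous_on_move2: "continuous_on UNIV (\<lambda>x. move c (fst x) (move d (snd x) p))"
proof -
  have *: "continuous_on UNIV (\<lambda>x. move c (h x) (q x))"
    if "continuous_on UNIV h" "continuous_on UNIV q" for c and h :: "real \<times> real \<Rightarrow> real" and q :: "real \<times> real \<Rightarrow> point"
  proof -
    define z w u where "z x = fst (q x)" and "w x = fst (snd (q x))" and "u x = snd (snd (q x))" for x
    then have q: "q = (\<lambda>x. (z x, w x, u x))" by simp
    have z: "continuous_on UNIV z" using continuous_on_fst[OF that(2)] by (simp add: q)
    have u: "continuous_on UNIV u" using continuous_on_snd[OF continuous_on_snd[OF that(2)]] by (simp add: q)
    have "continuous_on UNIV w" using continuous_on_fst[OF continuous_on_snd[OF that(2)]] by (simp add: q)
    then have w: "continuous_on UNIV (\<lambda>x. w x i)" for i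
      by (rule continuous_on_product_then_coordinatewise)
    have upd: "continuous_on UNIV (\<lambda>x. (w x)(i := a x))" if "continuous_on UNIV a" for i a
    proof (rule continuous_on_coordinatewise_then_product)
      show "continuous_on UNIV (\<lambda>x. ((w x)(i := a x)) j)" for j
        using that w by (cases "j = i") simp_all
    qed
    show ?thesis
      by (cases c) (simp_all add: q; intro continuous_intros upd that z u w continuous_on_coordinatewise_then_product)+
  qed
  show ?thesis by (intro * continuous_intros)
qed
lemma smooth_funD:
  assumes "smooth_fun k F"
  shows smooth_fun_same: "same_upto k p q \<Longrightarrow> F p = F q"
    and smooth_fun_continuous: "continuous_on UNIV F"
    and smooth_fun_differentiable: "(\<lambda>t. F (move c t p)) differentiable (at 0)"
proof -
  show "same_upto k p q \<Longrightarrow> F p = F q" using assms unfolding smooth_fun_def by blast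
  have *: "\<forall>cs. continuous_on UNIV (foldr rpartial cs F) \<and>
           (\<forall>c p. (\<lambda>t. foldr rpartial cs F (move c t p)) differentiable (at 0))"
    using assms by (simp add: smooth_fun_def)
  show "continuous_on UNIV F" "(\<lambda>t. F (move c t p)) differentiable (at 0)"
    using *[rule_format, of "[]"] by (auto simp del: split_paired_All)
qed

lemma smooth_fun_mono: "smooth_fun m F \<Longrightarrow> m \<le> n \<Longrightarrow> smooth_fun n F"
  unfolding smooth_fun_def using same_upto_mono by blast

lemma rpartial_same:
  assumes "\<And>p q. same_upto k p q \<Longrightarrow> F p = F q" "same_upto k p q"
  shows "rpartial c F p = rpartial c F q"
  unfolding rpartial_def using assms(1)[OF same_upto_move[OF assms(2)]] by simp

lemma smooth_fun_rpartial:
  assumes "smooth_fun k F" shows "smooth_fun k (rpartial c F)"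
  unfolding smooth_fun_def
proof (intro conjI allI impI)
  \<comment> \<open>\<open>foldr\<close> applies the last letter of the word first, so the new
    derivative is appended at the right end.\<close>
  have *: "foldr rpartial cs (rpartial c F) = foldr rpartial (cs @ [c]) F" for cs
    by simp
  show "continuous_on UNIV (foldr rpartial cs (rpartial c F))" for cs
    using assms unfolding * smooth_fun_def by (elim conjE allE)
  show "(\<lambda>t. foldr rpartial cs (rpartial c F) (move d t p)) differentiable at 0" for cs d p
    using assms unfolding * smooth_fun_def by (metis (no_types))
  show "rpartial c F p = rpartial c F q" if "same_upto k p q" for p q
    using rpartial_same[OF smooth_fun_same[OF assms] that] .
qed

text \<open>\<open>smooth_fun\<close> provides differentiability at parameter 0 only; translations
  in one coordinate form a one-parameter group, which reduces parameter t to parameter 0 at the base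
  point \<open>move c t p\<close>.\<close>

lemma has_rpartial:
  assumes "smooth_fun k F"
  shows "((\<lambda>t. F (move c t p)) has_vector_derivative rpartial c F (move c t p)) (at t)"
proof -
  let ?G = "\<lambda>s. F (move c s (move c t p))"
  have "(?G has_vector_derivative rpartial c F (move c t p)) (at 0)"
    unfolding rpartial_def using smooth_fun_differentiable[OF assms]
    by (simp add: vector_derivative_works)
  then have "(?G has_vector_derivative rpartial c F (move c t p)) (at (t - t))" by simp
  moreover have "((\<lambda>s. s - t) has_vector_derivative 1) (at t)"
    by (auto intro!: derivative_eq_intros)
  ultimately have "((?G \<circ> (\<lambda>s. s - t)) has_vector_derivative 1 *\<^sub>R rpartial c F (move c t p)) (at t)"
    by (intro vector_diff_chain_at)
  then show ?thesis by (simp add: o_def move_move)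
qed

lemma has_rpartial_0:
  assumes "smooth_fun k F"
  shows "((\<lambda>t. F (move c t p)) has_vector_derivative rpartial c F p) (at 0)"
  using has_rpartial[OF assms, of c p 0] by simp

lemma rpartial_commute:
  assumes F: "smooth_fun k F"
  shows "rpartial c (rpartial d F) = rpartial d (rpartial c F)"
proof
  fix p
  let ?m = "\<lambda>s t. move c s (move d t p)"
  have cont: "isCont (\<lambda>(s, t). G (?m s t)) (0, 0)" if "smooth_fun k G" for G
  proof -
    have "continuous_on UNIV (G \<circ> (\<lambda>x. ?m (fst x) (snd x)))"
      using continuous_on_move2 by (rule continuous_on_compose)
        (use smooth_fun_continuous[OF that] in \<open>auto intro: continuous_on_subset\<close>)
    then show ?thesis by (simp add: continuous_on_eq_continuous_at o_def case_prod_unfold)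
  qed
  have 1: "((\<lambda>s. G (?m s t)) has_vector_derivative rpartial c G (?m s t)) (at s)"
    if "smooth_fun k G" for G s t
    using that by (rule has_rpartial)
  have 2: "((\<lambda>t. G (?m s t)) has_vector_derivative rpartial d G (?m s t)) (at t)"
    if "smooth_fun k G" for G s t
    unfolding move_commute[of c _ d] using that by (rule has_rpartial)
  note smooth = F F[THEN smooth_fun_rpartial]
  have "rpartial d (rpartial c F) (?m 0 0) = rpartial c (rpartial d F) (?m 0 0)"
    by (rule mixed_derivatives[OF 1 2 2 1 cont cont]) (intro smooth smooth_fun_rpartial)+
  then show "rpartial c (rpartial d F) p = rpartial d (rpartial c F) p" by simp
qed

declare split_paired_All [simp del] split_paired_Ex [simp del]

subsection \<open>Smooth functions form a differential ring\<close>

text \<open>Every iterated derivative of F stays in S. Dependence on finitely many coordinates is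
  asked of F alone, as in \<open>smooth_fun\<close>.\<close>

lemma smooth_fun_coinduct:
  assumes "F \<in> S" "\<And>p q. same_upto k p q \<Longrightarrow> F p = F q"
    and "\<And>G. G \<in> S \<Longrightarrow> continuous_on UNIV G"
    and "\<And>G c p. G \<in> S \<Longrightarrow> (\<lambda>t. G (move c t p)) differentiable (at 0)"
    and "\<And>G c. G \<in> S \<Longrightarrow> rpartial c G \<in> S"
  shows "smooth_fun k F"
proof -
  have "foldr rpartial cs F \<in> S" for cs
    by (induction cs) (auto intro: assms)
  then show ?thesis
    unfolding smooth_fun_def using assms(2-4) by blast
qed

lemma rpartial_eqI:
  "((\<lambda>t. F (move c t p)) has_vector_derivative D) (at 0) \<Longrightarrow> rpartial c F p = D"
  unfolding rpartial_def by (rule vector_derivative_at)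

text \<open>
  The ring generated by the smooth functions is closed under \<open>rpartial\<close>, so its elements are smooth by
  coinduction; this avoids a Leibniz formula for iterated derivatives.
\<close>

inductive_set smooth_poly :: "nat \<Rightarrow> (point \<Rightarrow> complex) set" for k where
  base: "smooth_fun k F \<Longrightarrow> F \<in> smooth_poly k"
| add: "F \<in> smooth_poly k \<Longrightarrow> G \<in> smooth_poly k \<Longrightarrow> F + G \<in> smooth_poly k"
| mult: "F \<in> smooth_poly k \<Longrightarrow> G \<in> smooth_poly k \<Longrightarrow> F * G \<in> smooth_poly k"

text \<open>Existence of the derivative and membership are proved together: \<open>rpartial\<close>
  is identified with the sum or product rule expression only once the derivative exists, and that
  expression lies in the ring again.\<close>

lemma smooth_poly_has_rpartial:
  "F \<in> smooth_poly k \<Longrightarrow> rpartial c F \<in> smooth_poly k \<and>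
    (\<forall>p. ((\<lambda>t. F (move c t p)) has_vector_derivative rpartial c F p) (at 0))"
proof (induction rule: smooth_poly.induct)
  case (base F)
  then show ?case by (blast intro: smooth_poly.base smooth_fun_rpartial has_rpartial_0)
next
  case (add F G)
  have *: "((\<lambda>t. (F + G) (move c t p)) has_vector_derivative (rpartial c F + rpartial c G) p) (at 0)" for p
    unfolding plus_fun_apply using add by (intro has_vector_derivative_add) simp_all
  then have "rpartial c (F + G) = rpartial c F + rpartial c G"
    by (blast intro: rpartial_eqI)
  then show ?case using * add.IH smooth_poly.add by metis
next
  case (mult F G)
  have *: "((\<lambda>t. (F * G) (move c t p)) has_vector_derivative (F * rpartial c G + rpartial c F * G) p) (at 0)" for p
  proof -
    have "((\<lambda>t. F (move c t p) * G (move c t p)) has_vector_derivative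
        F (move c 0 p) * rpartial c G p + rpartial c F p * G (move c 0 p)) (at 0)"
      using mult by (intro has_vector_derivative_mult) simp_all
    then show ?thesis by simp
  qed
  then have "rpartial c (F * G) = F * rpartial c G + rpartial c F * G"
    by (blast intro: rpartial_eqI)
  then show ?case using * mult smooth_poly.add smooth_poly.mult by metis
qed

lemma smooth_poly_smooth:
  assumes "F \<in> smooth_poly k" shows "smooth_fun k F"
proof (rule smooth_fun_coinduct[OF assms])
  show "F p = F q" if "same_upto k p q" for p q
    using assms by induction (auto simp: smooth_fun_same[OF _ that])
  show "continuous_on UNIV G" if "G \<in> smooth_poly k" for G
    using that
  proof induction
    case (base F)
    then show ?case by (rule smooth_fun_continuous)
  qed (simp_all add: plus_fun_def times_fun_def continuous_on_add continuous_on_mult)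
qed (use smooth_poly_has_rpartial in \<open>blast intro: differentiableI_vector\<close>)+

lemma smooth_fun_add: "smooth_fun k F \<Longrightarrow> smooth_fun k G \<Longrightarrow> smooth_fun k (F + G)"
  and smooth_fun_mult: "smooth_fun k F \<Longrightarrow> smooth_fun k G \<Longrightarrow> smooth_fun k (F * G)"
  by (blast intro: smooth_poly_smooth smooth_poly.intros)+

lemma rpartial_const [simp]: "rpartial c (\<lambda>p. a) = (\<lambda>p. 0)"
  by (rule ext, rule rpartial_eqI) simp

lemma smooth_fun_const: "smooth_fun k (\<lambda>p. a)"
  by (rule smooth_fun_coinduct[where S = "{\<lambda>p. b |b. True}"]) auto

lemma smooth_fun_0: "smooth_fun k 0" and smooth_fun_1: "smooth_fun k 1"
  using smooth_fun_const[of k 0] smooth_fun_const[of k 1] by (simp_all add: zero_fun_def one_fun_def)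

lemma smooth_fun_uminus: "smooth_fun k F \<Longrightarrow> smooth_fun k (- F)"
  using smooth_fun_mult[OF smooth_fun_const[of k "-1"], of F] by (simp add: fun_Compl_def times_fun_def)

lemma smooth_fun_diff: "smooth_fun k F \<Longrightarrow> smooth_fun k G \<Longrightarrow> smooth_fun k (F - G)"
  using smooth_fun_add[OF _ smooth_fun_uminus, of k F G] by simp

lemma smooth_fun_sum: "(\<And>i. i \<in> I \<Longrightarrow> smooth_fun k (F i)) \<Longrightarrow> smooth_fun k (\<Sum>i\<in>I. F i)"
  by (induction I rule: infinite_finite_induct) (auto intro: smooth_fun_add smooth_fun_0)

lemma has_rpartial_cnj:
  "smooth_fun k F \<Longrightarrow> ((\<lambda>t. cnj (F (move c t p))) has_vector_derivative cnj (rpartial c F p)) (at 0)"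
  by (rule bounded_linear.has_vector_derivative[OF bounded_linear_cnj has_rpartial_0])

lemma rpartial_cnj: "smooth_fun k F \<Longrightarrow> rpartial c (\<lambda>p. cnj (F p)) = (\<lambda>p. cnj (rpartial c F p))"
  by (rule ext, rule rpartial_eqI, rule has_rpartial_cnj)

lemma smooth_fun_cnj:
  assumes "smooth_fun k F" shows "smooth_fun k (\<lambda>p. cnj (F p))"
proof (rule smooth_fun_coinduct[where S = "{\<lambda>p. cnj (F p) |F. smooth_fun k F}"])
  show "cnj (F p) = cnj (F q)" if "same_upto k p q" for p q
    using smooth_fun_same[OF assms that] by simp
  fix G c p assume "G \<in> {\<lambda>p. cnj (F p) |F. smooth_fun k F}"
  then obtain H where H: "smooth_fun k H" "G = (\<lambda>p. cnj (H p))" by blast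
  show "continuous_on UNIV G"
    unfolding H(2) by (intro continuous_on_cnj smooth_fun_continuous[OF H(1)])
  show "(\<lambda>t. G (move c t p)) differentiable at 0"
    unfolding H(2) by (rule differentiableI_vector[OF has_rpartial_cnj[OF H(1)]])
  show "rpartial c G \<in> {\<lambda>p. cnj (F p) |F. smooth_fun k F}"
    unfolding H(2) rpartial_cnj[OF H(1)] using smooth_fun_rpartial[OF H(1)] by blast
qed (use assms in blast)

lemma has_rpartial_uj:
  "((\<lambda>t. uj i (move c t p)) has_vector_derivative
     (if c = ReUi i then 1 else if c = ImUi i then \<i> else 0)) (at 0)"
  by (cases c; cases p) (auto intro!: derivative_eq_intros has_vector_derivative_real_field)

lemma rpartial_uj: "rpartial c (uj i) = (\<lambda>p. if c = ReUi i then 1 else if c = ImUi i then \<i> else 0)"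
  by (rule ext, rule rpartial_eqI, rule has_rpartial_uj)

lemma smooth_fun_uj: "smooth_fun i (uj i)"
proof (rule smooth_fun_coinduct[where S = "{uj i} \<union> {\<lambda>p. b |b. True}"])
  show "uj i p = uj i q" if "same_upto i p q" for p q
    using that by (cases p; cases q) auto
  have "continuous_on UNIV (uj i)"
  proof -
    have "uj i = (\<lambda>p. fst (snd p) i)" by (auto simp: fun_eq_iff)
    moreover have "continuous_on UNIV (\<lambda>p :: point. fst (snd p) i)"
      by (rule continuous_on_product_then_coordinatewise) (intro continuous_intros)
    ultimately show ?thesis by simp
  qed
  then show "continuous_on UNIV G" if "G \<in> {uj i} \<union> {\<lambda>p. b |b. True}" for G
    using that by auto
  show "(\<lambda>t. G (move c t p)) differentiable at 0" if "G \<in> {uj i} \<union> {\<lambda>p. b |b. True}" for G c p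
    using that by (auto intro: differentiableI_vector[OF has_rpartial_uj])
qed (auto simp: rpartial_uj)

lemma smooth_real_deriv: "smooth_real g \<Longrightarrow> smooth_real (deriv g)"
  unfolding smooth_real_def by (metis funpow_Suc_right comp_apply)

lemma has_rpartial_uval:
  assumes "smooth_real g"
  shows "((\<lambda>t. complex_of_real (g (uval (move c t p)))) has_vector_derivative
     (if c = RealU then of_real (deriv g (uval p)) else 0)) (at 0)"
proof (cases "c = RealU")
  case True
  have "g differentiable (at (uval p))"
    using assms unfolding smooth_real_def by (metis differentiable_on_eq_differentiable_at open_UNIV UNIV_I funpow_0)
  then have "(g has_real_derivative deriv g (uval p)) (at (0 + uval p))"
    by (simp add: DERIV_deriv_iff_real_differentiable)
  then have "((\<lambda>t. g (uval p + t)) has_real_derivative deriv g (uval p)) (at 0)"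
    unfolding DERIV_shift by (simp add: add.commute)
  then have "((\<lambda>t. complex_of_real (g (uval p + t))) has_vector_derivative of_real (deriv g (uval p))) (at 0)"
    by (intro has_vector_derivative_of_real)
      (simp add: has_real_derivative_iff_has_vector_derivative)
  moreover have "uval (move c t p) = uval p + t" for t
    using True by (cases p) simp
  ultimately show ?thesis using True by simp
next
  case False
  have "uval (move c t p) = uval p" for t
    using False by (cases c; cases p) auto
  then show ?thesis using False by simp
qed

lemma rpartial_uval: "smooth_real g \<Longrightarrow> rpartial c (\<lambda>p. of_real (g (uval p))) =
    (\<lambda>p. if c = RealU then of_real (deriv g (uval p)) else 0)"
  by (rule ext, rule rpartial_eqI, rule has_rpartial_uval)

lemma smooth_fun_uval:
  assumes "smooth_real g" shows "smooth_fun 0 (\<lambda>p. of_real (g (uval p)))"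
proof (rule smooth_fun_coinduct[where S = "{\<lambda>p. complex_of_real (g (uval p)) |g. smooth_real g} \<union> {\<lambda>p. 0 :: complex}"])
  show "complex_of_real (g (uval p)) = of_real (g (uval q))" if "same_upto 0 p q" for p q
    using that by (cases p; cases q) auto
  have "continuous_on UNIV (\<lambda>p. complex_of_real (g (uval p)))" if "smooth_real g" for g
  proof -
    have "g differentiable_on UNIV"
      using that unfolding smooth_real_def by (metis funpow_0)
    then have "continuous_on UNIV g"
      by (rule differentiable_imp_continuous_on)
    moreover have uval: "uval = (\<lambda>p. snd (snd p))" by (auto simp: fun_eq_iff)
    have "continuous_on UNIV uval"
      unfolding uval by (intro continuous_intros)
    ultimately have "continuous_on UNIV (\<lambda>p. g (uval p))"
      by (intro continuous_on_compose2[of UNIV g UNIV uval]) simp_all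
    then show ?thesis by (rule continuous_on_of_real)
  qed
  then show "continuous_on UNIV G"
    if "G \<in> {\<lambda>p. complex_of_real (g (uval p)) |g. smooth_real g} \<union> {\<lambda>p. 0 :: complex}" for G
    using that by auto
  show "rpartial c G \<in> {\<lambda>p. complex_of_real (g (uval p)) |g. smooth_real g} \<union> {\<lambda>p. 0 :: complex}"
    if "G \<in> {\<lambda>p. complex_of_real (g (uval p)) |g. smooth_real g} \<union> {\<lambda>p. 0 :: complex}" for G c
    using that by (cases "c = RealU") (auto simp: rpartial_uval dest: smooth_real_deriv)
  show "(\<lambda>t. G (move c t p)) differentiable at 0"
    if "G \<in> {\<lambda>p. complex_of_real (g (uval p)) |g. smooth_real g} \<union> {\<lambda>p. 0 :: complex}" for G c p
    using that by (auto intro: differentiableI_vector[OF has_rpartial_uval])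
qed (use assms in auto)

subsection \<open>Wirtinger derivatives\<close>

text \<open>The Wirtinger derivatives as identities in the ring of functions rather than at a point,
  so that the rules for \<open>rpartial\<close> apply by rewriting.\<close>

lemma partial_altdef:
  "partial Z F = (\<lambda>p. 1/2) * (rpartial ReZ F - (\<lambda>p. \<i>) * rpartial ImZ F)"
  "partial Zbar F = (\<lambda>p. 1/2) * (rpartial ReZ F + (\<lambda>p. \<i>) * rpartial ImZ F)"
  "partial U F = rpartial RealU F"
  "partial (Ui i) F = (\<lambda>p. 1/2) * (rpartial (ReUi i) F - (\<lambda>p. \<i>) * rpartial (ImUi i) F)"
  "partial (Uibar i) F = (\<lambda>p. 1/2) * (rpartial (ReUi i) F + (\<lambda>p. \<i>) * rpartial (ImUi i) F)"
  by (auto simp: fun_eq_iff)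

lemma smooth_fun_partial: "smooth_fun k F \<Longrightarrow> smooth_fun k (partial a F)"
  by (cases a) (auto simp: partial_altdef simp del: partial.simps intro!: smooth_fun_mult smooth_fun_add smooth_fun_diff
      smooth_fun_rpartial smooth_fun_const)

lemma rpartial_add:
  assumes "smooth_fun k F" "smooth_fun k G"
  shows "rpartial c (F + G) = rpartial c F + rpartial c G"
proof (rule ext, rule rpartial_eqI)
  show "((\<lambda>t. (F + G) (move c t p)) has_vector_derivative (rpartial c F + rpartial c G) p) (at 0)" for p
    unfolding plus_fun_apply using assms by (intro has_vector_derivative_add has_rpartial_0)
qed

lemma rpartial_mult:
  assumes "smooth_fun k F" "smooth_fun k G"
  shows "rpartial c (F * G) = F * rpartial c G + rpartial c F * G"
proof (rule ext, rule rpartial_eqI)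
  fix p
  have "((\<lambda>t. F (move c t p) * G (move c t p)) has_vector_derivative
      F (move c 0 p) * rpartial c G p + rpartial c F p * G (move c 0 p)) (at 0)"
    by (intro has_vector_derivative_mult has_rpartial_0[OF assms(1)] has_rpartial_0[OF assms(2)])
  then show "((\<lambda>t. (F * G) (move c t p)) has_vector_derivative (F * rpartial c G + rpartial c F * G) p) (at 0)"
    by simp
qed

lemma smooth_fun_infI: "smooth_fun k F \<Longrightarrow> smooth_fun_inf F"
  by (auto simp: smooth_fun_inf_def)

lemma smooth_fun_inf2E:
  assumes "smooth_fun_inf F" "smooth_fun_inf G"
  obtains k where "smooth_fun k F" "smooth_fun k G"
  using assms unfolding smooth_fun_inf_def
  by (metis smooth_fun_mono max.cobounded1 max.cobounded2)

named_theorems smooth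

lemma smooth_inf_add [smooth]: "smooth_fun_inf F \<Longrightarrow> smooth_fun_inf G \<Longrightarrow> smooth_fun_inf (F + G)"
  by (blast elim: smooth_fun_inf2E intro: smooth_fun_infI smooth_fun_add)

lemma smooth_inf_mult [smooth]: "smooth_fun_inf F \<Longrightarrow> smooth_fun_inf G \<Longrightarrow> smooth_fun_inf (F * G)"
  by (blast elim: smooth_fun_inf2E intro: smooth_fun_infI smooth_fun_mult)

lemma smooth_inf_diff [smooth]: "smooth_fun_inf F \<Longrightarrow> smooth_fun_inf G \<Longrightarrow> smooth_fun_inf (F - G)"
  by (blast elim: smooth_fun_inf2E intro: smooth_fun_infI smooth_fun_diff)

lemma smooth_inf_uminus [smooth]: "smooth_fun_inf F \<Longrightarrow> smooth_fun_inf (- F)"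
  unfolding smooth_fun_inf_def by (blast intro: smooth_fun_uminus)

lemma smooth_inf_const [smooth]: "smooth_fun_inf (\<lambda>p. a)"
  unfolding smooth_fun_inf_def by (blast intro: smooth_fun_const)

lemma smooth_inf_0 [smooth]: "smooth_fun_inf 0" and smooth_inf_1 [smooth]: "smooth_fun_inf 1"
  unfolding smooth_fun_inf_def by (blast intro: smooth_fun_0 smooth_fun_1)+

lemma smooth_inf_sum [smooth]:
  "(\<And>i. i \<in> I \<Longrightarrow> smooth_fun_inf (F i)) \<Longrightarrow> smooth_fun_inf (\<Sum>i\<in>I. F i)"
  by (induction I rule: infinite_finite_induct) (auto intro: smooth)

lemma smooth_inf_cnj [smooth]: "smooth_fun_inf F \<Longrightarrow> smooth_fun_inf (\<lambda>p. cnj (F p))"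
  unfolding smooth_fun_inf_def by (blast intro: smooth_fun_cnj)

lemma smooth_inf_partial [smooth]: "smooth_fun_inf F \<Longrightarrow> smooth_fun_inf (partial a F)"
  unfolding smooth_fun_inf_def by (blast intro: smooth_fun_partial)

lemma smooth_inf_uj [smooth]: "smooth_fun_inf (uj i)"
  unfolding smooth_fun_inf_def by (blast intro: smooth_fun_uj)

lemma partial_const [simp]: "partial a (\<lambda>p. b) = 0"
  by (cases a) (auto simp: fun_eq_iff)

lemma partial_0 [simp]: "partial a 0 = 0" and partial_1 [simp]: "partial a 1 = 0"
  unfolding zero_fun_def one_fun_def partial_const by (simp_all add: zero_fun_def)

lemma partial_add:
  assumes "smooth_fun_inf F" "smooth_fun_inf G"
  shows "partial a (F + G) = partial a F + partial a G"
proof -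
  obtain k where FG: "smooth_fun k F" "smooth_fun k G" using assms by (rule smooth_fun_inf2E)
  then show ?thesis
    by (cases a) (simp_all only: partial_altdef rpartial_add[OF FG] algebra_simps)
qed

lemma partial_mult:
  assumes "smooth_fun_inf F" "smooth_fun_inf G"
  shows "partial a (F * G) = F * partial a G + partial a F * G"
proof -
  obtain k where FG: "smooth_fun k F" "smooth_fun k G" using assms by (rule smooth_fun_inf2E)
  then show ?thesis
    by (cases a) (simp_all only: partial_altdef rpartial_mult[OF FG] algebra_simps)
qed

lemma partial_uminus: "smooth_fun_inf F \<Longrightarrow> partial a (- F) = - partial a F"
  using partial_add[of F "- F" a] by (simp add: smooth_inf_uminus add_eq_0_iff)

lemma partial_diff:
  "smooth_fun_inf F \<Longrightarrow> smooth_fun_inf G \<Longrightarrow> partial a (F - G) = partial a F - partial a G"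
  using partial_add[of F "- G" a] by (simp add: smooth_inf_uminus partial_uminus)

lemma partial_sum:
  "(\<And>i. i \<in> I \<Longrightarrow> smooth_fun_inf (F i)) \<Longrightarrow> partial a (\<Sum>i\<in>I. F i) = (\<Sum>i\<in>I. partial a (F i))"
  by (induction I rule: infinite_finite_induct) (auto simp: partial_add smooth_inf_sum)

lemma partial_cnj:
  assumes "smooth_fun_inf F"
  shows "partial a (\<lambda>p. cnj (F p)) = (\<lambda>p. cnj (partial (bar a) F p))"
  using assms unfolding smooth_fun_inf_def by (cases a) (auto simp: fun_eq_iff rpartial_cnj)

lemma partial_uj: "partial a (uj i) = (if a = Ui i then 1 else 0)"
  by (cases a) (auto simp: fun_eq_iff rpartial_uj)

lemma partial_uval:
  "smooth_real g \<Longrightarrow> partial a (\<lambda>p. of_real (g (uval p))) = (if a = U then (\<lambda>p. of_real (deriv g (uval p))) else 0)"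
  by (cases a) (auto simp: fun_eq_iff rpartial_uval)

lemma partial_commute:
  assumes "smooth_fun_inf F"
  shows "partial a (partial b F) = partial b (partial a F)"
proof -
  obtain k where F: "smooth_fun k F" using assms by (auto simp: smooth_fun_inf_def)
  note smooth_F = F[THEN smooth_fun_rpartial] F[THEN smooth_fun_rpartial, THEN smooth_fun_infI]
  have minus: "rpartial c (G - H) = rpartial c G - rpartial c H" if "smooth_fun k G" "smooth_fun k H" for c G H
    using rpartial_add[of k "G - H" H c] that by (simp add: smooth_fun_diff)
  have plus: "rpartial c (G + H) = rpartial c G + rpartial c H" if "smooth_fun k G" "smooth_fun k H" for c G H
    using that by (rule rpartial_add)
  have const: "rpartial c ((\<lambda>p. x) * G) = (\<lambda>p. x) * rpartial c G" if "smooth_fun k G" for c x G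
    using rpartial_mult[OF smooth_fun_const that] by (simp add: fun_eq_iff)
  have r: "rpartial c (partial b F) = partial b (rpartial c F)" for c
    by (cases b) (simp_all only: partial_altdef minus plus const smooth_fun_mult smooth_fun_const
        smooth_fun_diff smooth_fun_add smooth_F rpartial_commute[OF F])
  have const': "partial b ((\<lambda>p. x) * G) = (\<lambda>p. x) * partial b G" if "smooth_fun_inf G" for x G
    using partial_mult[OF smooth_inf_const that] by simp
  show ?thesis
    by (cases a) (simp_all only: partial_altdef[where F = "partial b F"] partial_altdef[where F = F] r
        const' partial_add partial_diff smooth smooth_F)
qed

lemma partial_zero:
  assumes "smooth_fun k F" "a \<notin> coords_upto k"
  shows "partial a F = 0"
proof -
  have *: "rpartial c F = (\<lambda>p. 0)" if "\<And>p t. same_upto k (move c t p) p" for c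
  proof -
    have "F (move c t p) = F p" for t p
      using smooth_fun_same[OF assms(1) that] .
    then show ?thesis unfolding rpartial_def by simp
  qed
  have "rpartial (ReUi i) F = (\<lambda>p. 0)" "rpartial (ImUi i) F = (\<lambda>p. 0)" if "i > k" for i
    using that by (auto intro!: *)
  then show ?thesis using assms(2)
    by (cases a) (auto simp: coords_upto_def fun_eq_iff image_iff not_le)
qed

lemma finite_coords_upto [simp]: "finite (coords_upto k)"
  by (simp add: coords_upto_def)

subsection \<open>Vector fields on finitely many coordinates\<close>

lemma sum_fun_apply: "(\<Sum>i\<in>I. F i) p = (\<Sum>i\<in>I. F i p)"
  by (induction I rule: infinite_finite_induct) auto

text \<open>
  \<open>e_m1 f\<close> has infinitely many components. All computations take place over a finite set \<open>S\<close> of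
  coordinates, which only has to be large enough for the functions and forms involved.
\<close>

definition deriv_on :: "coord set \<Rightarrow> vfield \<Rightarrow> (point \<Rightarrow> complex) \<Rightarrow> point \<Rightarrow> complex" where
  "deriv_on S X F = (\<Sum>a\<in>S. X a * partial a F)"

definition pairing :: "coord set \<Rightarrow> (coord \<Rightarrow> coord \<Rightarrow> point \<Rightarrow> complex) \<Rightarrow> vfield \<Rightarrow> vfield \<Rightarrow> point \<Rightarrow> complex" where
  "pairing S \<phi> X Y = (\<Sum>a\<in>S. \<Sum>b\<in>S. \<phi> a b * X a * Y b)"

definition bracket :: "coord set \<Rightarrow> vfield \<Rightarrow> vfield \<Rightarrow> vfield" where
  "bracket S X Y = (\<lambda>a. deriv_on S X (Y a) - deriv_on S Y (X a))"

text \<open>The sum defining \<open>apply_vf\<close> ranges over a set that varies with the point.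
  Here it becomes a fixed finite sum; S may be larger than necessary, so that several functions can
  share one set.\<close>

lemma apply_vf_eq_deriv_on:
  assumes "smooth_fun k F" "coords_upto k \<subseteq> S" "finite S"
  shows "apply_vf X F = deriv_on S X F"
proof
  fix p
  have "partial a F p = 0" if "a \<notin> S" for a
    using partial_zero[OF assms(1), of a] that assms(2) by (auto simp: fun_eq_iff)
  then show "apply_vf X F p = deriv_on S X F p"
    unfolding apply_vf_def deriv_on_def sum_fun_apply
    by (intro sum.mono_neutral_cong_left assms) (auto simp: assms)
qed

lemma smooth_deriv_on [smooth]:
  "(\<And>a. smooth_fun_inf (X a)) \<Longrightarrow> smooth_fun_inf F \<Longrightarrow> smooth_fun_inf (deriv_on S X F)"
  unfolding deriv_on_def by (intro smooth)

lemma smooth_pairing [smooth]: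
  "(\<And>a. smooth_fun_inf (X a)) \<Longrightarrow> (\<And>a. smooth_fun_inf (Y a)) \<Longrightarrow> (\<And>a b. smooth_fun_inf (\<phi> a b)) \<Longrightarrow>
   smooth_fun_inf (pairing S \<phi> X Y)"
  unfolding pairing_def by (intro smooth)

lemma deriv_on_0 [simp]: "deriv_on S X 0 = 0"
  by (simp add: deriv_on_def)

lemma deriv_on_add:
  "smooth_fun_inf F \<Longrightarrow> smooth_fun_inf G \<Longrightarrow> deriv_on S X (F + G) = deriv_on S X F + deriv_on S X G"
  by (simp add: deriv_on_def partial_add algebra_simps sum.distrib)

lemma deriv_on_uminus: "smooth_fun_inf F \<Longrightarrow> deriv_on S X (- F) = - deriv_on S X F"
  by (simp add: deriv_on_def partial_uminus sum_negf)

lemma deriv_on_sum: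
  "(\<And>i. i \<in> I \<Longrightarrow> smooth_fun_inf (F i)) \<Longrightarrow> deriv_on S X (\<Sum>i\<in>I. F i) = (\<Sum>i\<in>I. deriv_on S X (F i))"
  by (simp add: deriv_on_def partial_sum sum_distrib_left sum.swap[of _ S])

lemma deriv_on_mult:
  "smooth_fun_inf F \<Longrightarrow> smooth_fun_inf G \<Longrightarrow> deriv_on S X (F * G) = F * deriv_on S X G + deriv_on S X F * G"
  by (simp add: deriv_on_def partial_mult algebra_simps sum.distrib sum_distrib_left)

lemma deriv_on_const [simp]: "deriv_on S X (\<lambda>p. c) = 0"
  by (simp add: deriv_on_def)

lemma deriv_on_coord_vf: "finite S \<Longrightarrow> a \<in> S \<Longrightarrow> deriv_on S (coord_vf a) F = partial a F"
proof -
  assume "finite S" "a \<in> S"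
  have "coord_vf a b * partial b F = (if b = a then partial a F else 0)" for b
    by (auto simp: coord_vf_def fun_eq_iff)
  then show ?thesis using \<open>finite S\<close> \<open>a \<in> S\<close> by (simp add: deriv_on_def)
qed

lemma deriv_on_cnj:
  assumes "smooth_fun_inf F" "bar ` S = S"
  shows "deriv_on S (cnj_vf X) (\<lambda>p. cnj (F p)) = (\<lambda>p. cnj (deriv_on S X F p))"
proof
  fix p
  have bar_bar: "bar (bar a) = a" for a by (cases a) auto
  have "deriv_on S (cnj_vf X) (\<lambda>p. cnj (F p)) p = (\<Sum>a\<in>S. cnj (X (bar a) p * partial (bar a) F p))"
    by (simp add: deriv_on_def sum_fun_apply partial_cnj assms cnj_vf_def)
  also have "\<dots> = (\<Sum>a\<in>bar ` S. cnj (X a p * partial a F p))"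
    by (subst sum.reindex) (auto intro: inj_on_inverseI[of _ bar] simp: bar_bar)
  finally show "deriv_on S (cnj_vf X) (\<lambda>p. cnj (F p)) p = cnj (deriv_on S X F p)"
    by (simp add: assms deriv_on_def sum_fun_apply)
qed

text \<open>The second-order parts agree since partial derivatives commute, which leaves a
  first-order operator. This is exact on S even if the components depend on coordinates outside
  S.\<close>

lemma deriv_on_commutator:
  assumes "\<And>a. smooth_fun_inf (X a)" "\<And>a. smooth_fun_inf (Y a)" "smooth_fun_inf F"
  shows "deriv_on S X (deriv_on S Y F) - deriv_on S Y (deriv_on S X F) = deriv_on S (bracket S X Y) F"
proof -
  have *: "deriv_on S X (deriv_on S Y F) =
      deriv_on S (\<lambda>a. deriv_on S X (Y a)) F + (\<Sum>a\<in>S. \<Sum>b\<in>S. X a * Y b * partial a (partial b F))"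
    if "\<And>a. smooth_fun_inf (X a)" "\<And>a. smooth_fun_inf (Y a)" for X Y
  proof -
    have "deriv_on S X (deriv_on S Y F) =
        (\<Sum>a\<in>S. \<Sum>b\<in>S. X a * (Y b * partial a (partial b F) + partial a (Y b) * partial b F))"
      using that assms(3) by (simp add: deriv_on_def partial_sum partial_mult smooth sum_distrib_left)
    also have "\<dots> = (\<Sum>b\<in>S. \<Sum>a\<in>S. X a * partial a (Y b) * partial b F) + (\<Sum>a\<in>S. \<Sum>b\<in>S. X a * Y b * partial a (partial b F))"
      by (subst sum.swap[of _ S S]) (simp add: algebra_simps sum.distrib)
    finally show ?thesis
      by (simp add: deriv_on_def sum_distrib_right)
  qed
  have "(\<Sum>a\<in>S. \<Sum>b\<in>S. X a * Y b * partial a (partial b F)) = (\<Sum>a\<in>S. \<Sum>b\<in>S. Y a * X b * partial a (partial b F))"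
    by (subst sum.swap) (simp add: partial_commute[OF assms(3)] mult.commute mult.left_commute)
  then show ?thesis
    by (simp add: * assms(1,2)) (simp add: deriv_on_def bracket_def algebra_simps sum_subtractf)
qed

lemma pairing_diff_left: "pairing S \<phi> (\<lambda>a. X a - X' a) Y = pairing S \<phi> X Y - pairing S \<phi> X' Y"
  by (simp add: pairing_def algebra_simps sum_subtractf)

lemma pairing_flip:
  assumes "\<And>a b. \<phi> a b = - \<phi> b a"
  shows "pairing S \<phi> X Y = - pairing S \<phi> Y X"
proof -
  have "pairing S \<phi> X Y = (\<Sum>b\<in>S. \<Sum>a\<in>S. \<phi> a b * X a * Y b)"
    unfolding pairing_def by (rule sum.swap)
  also have "\<dots> = (\<Sum>b\<in>S. \<Sum>a\<in>S. - (\<phi> b a * Y b * X a))"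
    by (intro sum.cong refl, subst assms) (simp add: algebra_simps)
  finally show ?thesis by (simp add: pairing_def sum_negf)
qed

lemma deriv_on_pairing:
  assumes "\<And>a. smooth_fun_inf (X a)" "\<And>a. smooth_fun_inf (Y a)" "\<And>a b. smooth_fun_inf (\<phi> a b)"
  shows "deriv_on S Q (pairing S \<phi> X Y) = (\<Sum>a\<in>S. \<Sum>b\<in>S. deriv_on S Q (\<phi> a b) * X a * Y b)
    + pairing S \<phi> (\<lambda>a. deriv_on S Q (X a)) Y + pairing S \<phi> X (\<lambda>a. deriv_on S Q (Y a))"
  using assms by (simp add: pairing_def deriv_on_sum deriv_on_mult smooth) (simp add: algebra_simps sum.distrib)

lemma sum_rotate: "(\<Sum>b\<in>B. \<Sum>c\<in>C. \<Sum>a\<in>A. g a b c) = (\<Sum>a\<in>A. \<Sum>b\<in>B. \<Sum>c\<in>C. g a b c)"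
proof -
  have "(\<Sum>b\<in>B. \<Sum>c\<in>C. \<Sum>a\<in>A. g a b c) = (\<Sum>b\<in>B. \<Sum>a\<in>A. \<Sum>c\<in>C. g a b c)"
    by (intro sum.cong refl sum.swap)
  also have "\<dots> = (\<Sum>a\<in>A. \<Sum>b\<in>B. \<Sum>c\<in>C. g a b c)"
    by (rule sum.swap)
  finally show ?thesis .
qed

text \<open>\<open>d\<phi>(X, Y, W) = 0\<close> in invariant form, i.e. expressed through Lie brackets.\<close>

lemma closed_form_identity:
  assumes anti: "\<And>a b. \<phi> a b = - \<phi> b a"
    and closed: "\<And>a b c. partial a (\<phi> b c) - partial b (\<phi> a c) + partial c (\<phi> a b) = 0"
    and sm: "\<And>a. smooth_fun_inf (X a)" "\<And>a. smooth_fun_inf (Y a)" "\<And>a. smooth_fun_inf (W a)"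
      "\<And>a b. smooth_fun_inf (\<phi> a b)"
  shows "deriv_on S X (pairing S \<phi> Y W) - deriv_on S Y (pairing S \<phi> X W) + deriv_on S W (pairing S \<phi> X Y)
    - pairing S \<phi> (bracket S X Y) W + pairing S \<phi> (bracket S X W) Y - pairing S \<phi> (bracket S Y W) X = 0"
proof -
  \<comment> \<open>In all three sums the indices a, b, c are made to belong to X, Y, W, so that
    \<open>closed\<close> applies term by term.\<close>
  have 1: "(\<Sum>b\<in>S. \<Sum>c\<in>S. deriv_on S X (\<phi> b c) * Y b * W c)
      = (\<Sum>a\<in>S. \<Sum>b\<in>S. \<Sum>c\<in>S. partial a (\<phi> b c) * X a * Y b * W c)"
    by (subst sum_rotate[symmetric]) (simp add: deriv_on_def sum_distrib_left sum_distrib_right algebra_simps)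
  have 2: "(\<Sum>a\<in>S. \<Sum>c\<in>S. deriv_on S Y (\<phi> a c) * X a * W c)
      = (\<Sum>a\<in>S. \<Sum>b\<in>S. \<Sum>c\<in>S. partial b (\<phi> a c) * X a * Y b * W c)"
    by (subst (2) sum.swap[of _ S S])
      (simp add: deriv_on_def sum_distrib_left sum_distrib_right algebra_simps)
  have 3: "(\<Sum>a\<in>S. \<Sum>b\<in>S. deriv_on S W (\<phi> a b) * X a * Y b)
      = (\<Sum>a\<in>S. \<Sum>b\<in>S. \<Sum>c\<in>S. partial c (\<phi> a b) * X a * Y b * W c)"
    by (simp add: deriv_on_def sum_distrib_left sum_distrib_right algebra_simps)
  have "(\<Sum>a\<in>S. \<Sum>b\<in>S. \<Sum>c\<in>S. partial a (\<phi> b c) * X a * Y b * W c)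
      - (\<Sum>a\<in>S. \<Sum>b\<in>S. \<Sum>c\<in>S. partial b (\<phi> a c) * X a * Y b * W c)
      + (\<Sum>a\<in>S. \<Sum>b\<in>S. \<Sum>c\<in>S. partial c (\<phi> a b) * X a * Y b * W c)
      = (\<Sum>a\<in>S. \<Sum>b\<in>S. \<Sum>c\<in>S. (partial a (\<phi> b c) - partial b (\<phi> a c) + partial c (\<phi> a b)) * (X a * Y b * W c))"
    by (simp add: algebra_simps sum.distrib sum_subtractf)
  then have 4: "(\<Sum>b\<in>S. \<Sum>c\<in>S. deriv_on S X (\<phi> b c) * Y b * W c)
      - (\<Sum>a\<in>S. \<Sum>c\<in>S. deriv_on S Y (\<phi> a c) * X a * W c)
      + (\<Sum>a\<in>S. \<Sum>b\<in>S. deriv_on S W (\<phi> a b) * X a * Y b) = 0"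
    unfolding 1 2 3 by (simp add: closed)
  \<comment> \<open>Only terms with a differentiated component of X, Y or W remain; antisymmetry
    brings these components to the first slot, where they combine to brackets.\<close>
  show ?thesis
    unfolding bracket_def pairing_diff_left
      deriv_on_pairing[of Y W \<phi>, OF sm(2,3,4)] deriv_on_pairing[of X W \<phi>, OF sm(1,3,4)]
      deriv_on_pairing[of X Y \<phi>, OF sm(1,2,4)]
    using 4 pairing_flip[OF anti, of S _ X] pairing_flip[OF anti, of S _ Y]
    by (simp add: algebra_simps)
qed

subsection \<open>The functions \<open>T\<^sup>i\<close> and the total derivative\<close>

lemma partial_of_nat [simp]: "partial a (of_nat n) = 0"
  unfolding of_nat_fun by simp

lemma smooth_of_nat [smooth]: "smooth_fun_inf (of_nat n)"
  unfolding of_nat_fun by (rule smooth)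

lemma T_Suc: "T f (Suc i) = (\<Sum>j\<le>i. of_nat (i choose j) * uj (i - j) * partial U (T f j))"
  by (simp add: fun_eq_iff sum_fun_apply)

declare T.simps(2) [simp del]

lemma smooth_fun_T: "smooth_real f \<Longrightarrow> smooth_fun i (T f i)"
proof (induction i rule: less_induct)
  case (less i)
  show ?case
  proof (cases i)
    case 0
    then show ?thesis using smooth_fun_uval[OF less.prems] by simp
  next
    case (Suc n)
    have "smooth_fun i (of_nat (n choose j) * uj (n - j) * partial U (T f j))" if "j \<le> n" for j
      unfolding of_nat_fun using less that Suc
      by (intro smooth_fun_mult smooth_fun_const smooth_fun_partial)
        (auto intro: smooth_fun_mono[OF smooth_fun_uj] smooth_fun_mono[OF less.IH])
    then show ?thesis unfolding Suc T_Suc by (intro smooth_fun_sum) (auto simp: Suc)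
  qed
qed

lemma smooth_T [smooth]: "smooth_real f \<Longrightarrow> smooth_fun_inf (T f i)"
  by (blast intro: smooth_fun_infI smooth_fun_T)

text \<open>By the recursion T^i is a polynomial in u_0, ..., u_(i-1) with derivatives of f at u as
  coefficients; no conjugate coordinate enters.\<close>

lemma partial_T_eq_0:
  assumes "smooth_real f"
  shows "a \<notin> insert U (Ui ` {..<i}) \<Longrightarrow> partial a (T f i) = 0"
proof (induction i arbitrary: a rule: less_induct)
  case (less i)
  show ?case
  proof (cases i)
    case 0
    then show ?thesis using less.prems partial_uval[OF assms, of a] by simp
  next
    case (Suc n)
    have "partial a (of_nat (n choose j) * uj (n - j) * partial U (T f j)) = 0" if "j \<le> n" for j
    proof -
      have "partial a (uj (n - j)) = 0"
        using less.prems Suc by (auto simp: partial_uj)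
      moreover have "partial a (partial U (T f j)) = 0"
      proof -
        have "partial a (T f j) = 0"
          using less.prems Suc that by (intro less.IH) auto
        then show ?thesis
          by (simp only: partial_commute[OF smooth_T[OF assms], of a] partial_0)
      qed
      ultimately show ?thesis
        using assms by (simp add: partial_mult smooth)
    qed
    then show ?thesis
      using assms unfolding Suc T_Suc by (simp add: partial_sum smooth)
  qed
qed

lemma smooth_e_m1 [smooth]: "smooth_real f \<Longrightarrow> smooth_fun_inf (e_m1 f a)"
proof (cases a)
  case (Uibar i)
  assume "smooth_real f"
  then have "smooth_fun_inf (- (\<lambda>p. cnj (T f i p)))" by (intro smooth)
  then show ?thesis using Uibar by (simp add: fun_Compl_def)
qed (simp_all add: smooth)

lemma deriv_on_coord_vf_eq_0 [simp]: "deriv_on S X (coord_vf a b) = 0"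
  by (cases "a = b") (simp_all add: coord_vf_def)

lemma bracket_coord_vf: "finite S \<Longrightarrow> a \<in> S \<Longrightarrow> bracket S X (coord_vf a) = (\<lambda>b. - partial a (X b))"
  by (simp add: bracket_def deriv_on_coord_vf)

lemma smooth_cnj_vf [smooth]: "(\<And>a. smooth_fun_inf (X a)) \<Longrightarrow> smooth_fun_inf (cnj_vf X a)"
  unfolding cnj_vf_def by (intro smooth)

lemma smooth_coord_vf [smooth]: "smooth_fun_inf (coord_vf a b)"
  unfolding coord_vf_def by (cases "a = b") (simp_all add: smooth)

lemma coords_upto_mono: "m \<le> n \<Longrightarrow> coords_upto m \<subseteq> coords_upto n"
  by (auto simp: coords_upto_def)

lemma bar_coords_upto: "bar ` coords_upto k = coords_upto k"
  by (auto simp: coords_upto_def image_Un image_image)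

lemma partial_U_e_m1:
  "partial U (e_m1 f a) = (case a of Uibar l \<Rightarrow> - partial U (\<lambda>p. cnj (T f l p)) | _ \<Rightarrow> 0)"
  if "smooth_real f" for a
proof (cases a)
  case (Uibar l)
  have "e_m1 f a = - (\<lambda>p. cnj (T f l p))" using Uibar by (simp add: fun_Compl_def)
  then show ?thesis using Uibar that by (simp add: partial_uminus smooth)
qed (auto simp: partial_uj)

text \<open>The recursion for T is the Leibniz rule for E^i applied to E f = u_0 f_u, where E^(i-j)
  u_0 = u_(i-j); hence T^i = E^i f. The induction uses that E commutes with the u-derivative on the
  T^j, and Pascal's rule. The result is needed for [E, E'] = 0.\<close>

lemma deriv_on_T:
  assumes f: "smooth_real f"
  shows "i \<le> N \<Longrightarrow> deriv_on (coords_upto N) (e_m1 f) (T f i) = T f (Suc i)"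
proof (induction i rule: less_induct)
  case (less i)
  let ?S = "coords_upto N" and ?E = "e_m1 f"
  have "U \<in> ?S" by (simp add: coords_upto_def)
  have U: "deriv_on ?S ?E (partial U (T f j)) = partial U (T f (Suc j))" if "j < i" for j
  proof -
    have "deriv_on ?S ?E (partial U (T f j)) - partial U (deriv_on ?S ?E (T f j))
        = deriv_on ?S (bracket ?S ?E (coord_vf U)) (T f j)"
      using deriv_on_commutator[of ?E "coord_vf U" "T f j" ?S] f
      by (simp add: smooth deriv_on_coord_vf \<open>U \<in> ?S\<close>)
    \<comment> \<open>The bracket of E with the u-derivative has components only along conjugates of
      the u_l, on which T^j does not depend.\<close>
    also have "\<dots> = 0"
    proof -
      have "bracket ?S ?E (coord_vf U) a * partial a (T f j) = 0" for a
      proof (cases a)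
        case (Uibar l)
        then have "partial a (T f j) = 0" by (intro partial_T_eq_0[OF f]) auto
        then show ?thesis by simp
      qed (simp_all add: bracket_coord_vf \<open>U \<in> ?S\<close> partial_U_e_m1[OF f])
      then show ?thesis unfolding deriv_on_def by simp
    qed
    finally show ?thesis using less.IH[of j] less.prems that by simp
  qed
  have uj: "deriv_on ?S ?E (uj l) = uj (Suc l)" if "l \<le> N" for l
  proof -
    have "?E a * partial a (uj l) = (if a = Ui l then uj (Suc l) else 0)" for a
      by (auto simp: partial_uj)
    then show ?thesis using that by (simp add: deriv_on_def coords_upto_def)
  qed
  show ?case
  proof (cases i)
    case 0
    have "?E a * partial a (T f 0) = (if a = U then uj 0 * partial U (T f 0) else 0)" for a
      using partial_T_eq_0[OF f, of a 0] by auto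
    then show ?thesis using 0 by (simp add: deriv_on_def coords_upto_def T_Suc)
  next
    case (Suc n)
    have "deriv_on ?S ?E (T f i) = (\<Sum>j\<le>n. of_nat (n choose j) *
        (uj (Suc n - j) * partial U (T f j) + uj (n - j) * partial U (T f (Suc j))))"
    proof -
      have "deriv_on ?S ?E (of_nat m) = 0" for m by (simp add: deriv_on_def)
      then show ?thesis
        using f U uj less.prems unfolding Suc T_Suc[of f n]
        by (simp add: deriv_on_sum deriv_on_mult smooth algebra_simps Suc_diff_le)
    qed
    also have "\<dots> = (\<Sum>j\<le>n. of_nat (n choose j) * uj (Suc n - j) * partial U (T f j))
        + (\<Sum>j\<le>n. of_nat (n choose j) * uj (n - j) * partial U (T f (Suc j)))"
      by (simp add: algebra_simps sum.distrib)
    \<comment> \<open>A summand with the vanishing coefficient \<open>n choose Suc n\<close> is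
      added, so that splitting off j = 0 leaves a sum as long as the other one.\<close>
    also have "(\<Sum>j\<le>n. of_nat (n choose j) * uj (Suc n - j) * partial U (T f j))
        = (\<Sum>j\<le>Suc n. of_nat (n choose j) * uj (Suc n - j) * partial U (T f j))"
      by (simp add: binomial_eq_0)
    also have "\<dots> = uj (Suc n) * partial U (T f 0) +
        (\<Sum>j\<le>n. of_nat (n choose Suc j) * uj (n - j) * partial U (T f (Suc j)))"
      by (subst sum.atMost_Suc_shift) simp
    also have "\<dots> + (\<Sum>j\<le>n. of_nat (n choose j) * uj (n - j) * partial U (T f (Suc j)))
      = uj (Suc n) * partial U (T f 0) +
        (\<Sum>j\<le>n. of_nat (Suc n choose Suc j) * uj (n - j) * partial U (T f (Suc j)))"
      by (simp add: algebra_simps sum.distrib)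
    also have "\<dots> = T f (Suc (Suc n))"
      unfolding T_Suc[of f "Suc n"] by (subst sum.atMost_Suc_shift) simp
    finally show ?thesis using Suc by simp
  qed
qed

subsection \<open>Forms of degree one and two\<close>

lemma has_degreeD: "has_degree n \<alpha> \<Longrightarrow> length as \<noteq> n \<Longrightarrow> \<alpha> as = 0"
  by (auto simp: has_degree_def fun_eq_iff)

lemma has_degree_add: "has_degree n \<alpha> \<Longrightarrow> has_degree n \<beta> \<Longrightarrow> has_degree n (\<alpha> + \<beta>)"
  and has_degree_diff: "has_degree n \<alpha> \<Longrightarrow> has_degree n \<beta> \<Longrightarrow> has_degree n (\<alpha> - \<beta>)"
  and has_degree_smult: "has_degree n \<alpha> \<Longrightarrow> has_degree n (F \<cdot> \<alpha>)"
  and has_degree_cnj: "has_degree n \<alpha> \<Longrightarrow> has_degree n (cnj_form \<alpha>)"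
  and has_degree_dcoord: "has_degree 1 (dcoord a)"
  by (auto simp: has_degree_def smult_form_def cnj_form_def dcoord_def)

lemma has_degree_zeta: "has_degree 1 zeta"
  unfolding zeta_def by (rule has_degree_dcoord)

lemma has_degree_omega: "has_degree 1 (omega f i)"
  unfolding omega_def zeta_def
  by (intro has_degree_add has_degree_smult has_degree_cnj has_degree_dcoord)

lemma has_degree_eta: "has_degree 1 (eta f i)"
  unfolding eta_def
  by (cases "i = 0"; simp only: if_True if_False refl)
    (intro has_degree_diff has_degree_smult has_degree_cnj has_degree_dcoord has_degree_zeta has_degree_omega)+

lemma has_degree_wedge:
  assumes "has_degree m \<alpha>" "has_degree n \<beta>"
  shows "has_degree (m + n) (\<alpha> \<and>\<^sub>f \<beta>)"
  unfolding has_degree_def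
proof (intro allI impI)
  fix as :: "coord list" and p assume len: "length as \<noteq> m + n"
  have zero: "\<alpha> (nths as S) p * \<beta> (nths as (- S)) p = 0" for S
  proof -
    have "length (nths as S) + length (nths as (- S)) = length as"
    proof -
      have "{i. i < length as \<and> i \<in> S} \<union> {i. i < length as \<and> i \<in> - S} = {..<length as}" by auto
      then show ?thesis
        unfolding length_nths
        using card_Un_disjoint[of "{i. i < length as \<and> i \<in> S}" "{i. i < length as \<and> i \<in> - S}"]
        by simp fastforce
    qed
    with len have "length (nths as S) \<noteq> m \<or> length (nths as (- S)) \<noteq> n" by linarith
    then show ?thesis
      using assms by (auto simp: has_degree_def)
  qed
  show "(\<alpha> \<and>\<^sub>f \<beta>) as p = 0"
    unfolding wedge_def mult.assoc zero by simp
qed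

text \<open>Of the four sets of positions only the two singletons matter, because a 1-form vanishes
  on lists of any other length.\<close>

lemma wedge_apply:
  assumes "has_degree 1 \<alpha>" "has_degree 1 \<beta>"
  shows "(\<alpha> \<and>\<^sub>f \<beta>) [a, b] = \<alpha> [a] * \<beta> [b] - \<alpha> [b] * \<beta> [a]"
proof
  fix p
  have Pow2: "Pow {..<2::nat} = {{}, {0}, {1}, {0, 1}}"
    by (simp add: numeral_2_eq_2 lessThan_Suc Pow_insert) auto
  define s :: "nat set \<Rightarrow> complex"
    where "s S = (-1) ^ card {(i, j). i \<in> S \<and> j \<in> {..<2} - S \<and> j < i}" for S
  have "{(i, j). i \<in> {0} \<and> j \<in> {..<2::nat} - {0} \<and> j < i} = {}"
    "{(i, j). i \<in> {1} \<and> j \<in> {..<2::nat} - {1} \<and> j < i} = {(1, 0)}" by auto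
  then have s: "s {0} = 1" "s {1} = -1" by (simp_all only: s_def) simp_all
  have nil: "\<alpha> [] = 0" "\<beta> [] = 0" using assms by (auto simp: has_degreeD)
  have len: "length [a, b] = 2" by simp
  have "(\<alpha> \<and>\<^sub>f \<beta>) [a, b] p = (\<Sum>S\<in>{{}, {0}, {1}, {0, 1}}. s S * \<alpha> (nths [a, b] S) p * \<beta> (nths [a, b] (- S)) p)"
    unfolding wedge_def len Pow2 s_def ..
  then show "(\<alpha> \<and>\<^sub>f \<beta>) [a, b] p = (\<alpha> [a] * \<beta> [b] - \<alpha> [b] * \<beta> [a]) p"
    using s by (simp add: nths_Cons nil)
qed

lemma smult_form_apply: "(F \<cdot> \<alpha>) as = F * \<alpha> as"
  by (auto simp: smult_form_def)

lemma ext_d_two_form_apply: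
  "ext_d \<Phi> [a, b, c] = partial a (\<Phi> [b, c]) - partial b (\<Phi> [a, c]) + partial c (\<Phi> [a, b])"
  by (rule ext) (simp add: ext_d_def eval_nat_numeral)

lemma ext_d_fun_form: "ext_d (fun_form F) as = (if length as = 1 then partial (hd as) F else 0)"
proof (rule ext)
  fix p
  have fun_form_Nil: "fun_form F [] = F" and fun_form: "xs \<noteq> [] \<Longrightarrow> fun_form F xs = (\<lambda>p. 0)" for xs
    by (auto simp: fun_form_def)
  have "take i as @ drop (Suc i) as \<noteq> []" if "length as \<noteq> 1" "i < length as" for i
  proof -
    have "length (take i as @ drop (Suc i) as) \<noteq> 0" using that by simp
    then show ?thesis by blast
  qed
  then show "ext_d (fun_form F) as p = (if length as = 1 then partial (hd as) F else 0) p"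
    by (auto simp: ext_d_def fun_form fun_form_Nil hd_conv_nth length_Suc_conv)
qed

definition eval_form :: "coord set \<Rightarrow> form \<Rightarrow> vfield \<Rightarrow> point \<Rightarrow> complex" where
  "eval_form S \<alpha> X = (\<Sum>a\<in>S. \<alpha> [a] * X a)"

lemma interior_prod_Nil:
  assumes "form_on k \<alpha>" "coords_upto k \<subseteq> S" "finite S"
  shows "interior_prod X \<alpha> [] = eval_form S \<alpha> X"
proof
  fix p
  have "\<alpha> [a] p = 0" if "a \<notin> S" for a
  proof -
    have "\<not> set [a] \<subseteq> coords_upto k" using that assms(2) by auto
    then show ?thesis using assms(1) unfolding form_on_def by blast
  qed
  then show "interior_prod X \<alpha> [] p = eval_form S \<alpha> X p"
    unfolding interior_prod_def eval_form_def sum_fun_apply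
    by (intro sum.mono_neutral_cong_left assms) (auto simp: assms)
qed

lemma eval_form_add: "eval_form S (\<alpha> + \<beta>) X = eval_form S \<alpha> X + eval_form S \<beta> X"
  and eval_form_diff: "eval_form S (\<alpha> - \<beta>) X = eval_form S \<alpha> X - eval_form S \<beta> X"
  and eval_form_smult: "eval_form S (F \<cdot> \<alpha>) X = F * eval_form S \<alpha> X"
  by (simp_all add: eval_form_def algebra_simps sum.distrib sum_subtractf sum_distrib_left smult_form_apply)

lemma eval_form_dcoord: "finite S \<Longrightarrow> a \<in> S \<Longrightarrow> eval_form S (dcoord a) X = X a"
proof -
  assume *: "finite S" "a \<in> S"
  have "dcoord a [b] * X b = (if b = a then X a else 0)" for b
    by (auto simp: dcoord_def fun_eq_iff)
  then show ?thesis using * by (simp add: eval_form_def)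
qed

lemma eval_form_coord_vf: "finite S \<Longrightarrow> a \<in> S \<Longrightarrow> eval_form S \<alpha> (coord_vf a) = \<alpha> [a]"
proof -
  assume *: "finite S" "a \<in> S"
  have "\<alpha> [b] * coord_vf a b = (if b = a then \<alpha> [a] else 0)" for b
    by (auto simp: coord_vf_def fun_eq_iff)
  then show ?thesis using * by (simp add: eval_form_def)
qed

text \<open>Conjugation as an operator on functions, so that identities between functions can be
  rewritten without evaluating at a point.\<close>

definition cnj_fun :: "(point \<Rightarrow> complex) \<Rightarrow> point \<Rightarrow> complex" where
  "cnj_fun F = (\<lambda>p. cnj (F p))"

lemma cnj_form_add: "cnj_form (\<alpha> + \<beta>) = cnj_form \<alpha> + cnj_form \<beta>"
  and cnj_form_diff: "cnj_form (\<alpha> - \<beta>) = cnj_form \<alpha> - cnj_form \<beta>"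
  and cnj_form_smult: "cnj_form (F \<cdot> \<alpha>) = cnj_fun F \<cdot> cnj_form \<alpha>"
  by (auto simp: cnj_form_def smult_form_def cnj_fun_def fun_eq_iff)

lemma bar_bar [simp]: "bar (bar a) = a"
  by (cases a) auto

lemma cnj_form_dcoord: "cnj_form (dcoord a) = dcoord (bar a)"
proof -
  have "map bar as = [a] \<longleftrightarrow> as = [bar a]" for as
    by (cases as) auto
  then show ?thesis by (auto simp: cnj_form_def dcoord_def fun_eq_iff)
qed

lemma pairing_add: "pairing S (\<lambda>a b. \<phi> a b + \<psi> a b) X Y = pairing S \<phi> X Y + pairing S \<psi> X Y"
  and pairing_diff: "pairing S (\<lambda>a b. \<phi> a b - \<psi> a b) X Y = pairing S \<phi> X Y - pairing S \<psi> X Y"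
  and pairing_smult: "pairing S (\<lambda>a b. F * \<phi> a b) X Y = F * pairing S \<phi> X Y"
  by (simp_all add: pairing_def algebra_simps sum.distrib sum_subtractf sum_distrib_left)

lemma pairing_sum: "pairing S (\<lambda>a b. \<Sum>i\<in>I. \<phi> i a b) X Y = (\<Sum>i\<in>I. pairing S (\<phi> i) X Y)"
proof (induction I rule: infinite_finite_induct)
  case (insert x F)
  show ?case unfolding sum.insert[OF insert.hyps] pairing_add insert.IH ..
next
  case (infinite I)
  show ?case unfolding sum.infinite[OF infinite] pairing_def mult_zero_left sum.neutral_const ..
next
  case empty
  show ?case unfolding sum.empty pairing_def mult_zero_left sum.neutral_const ..
qed

lemma pairing_wedge:
  assumes "has_degree 1 \<alpha>" "has_degree 1 \<beta>"
  shows "pairing S (\<lambda>a b. (\<alpha> \<and>\<^sub>f \<beta>) [a, b]) X Y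
    = eval_form S \<alpha> X * eval_form S \<beta> Y - eval_form S \<alpha> Y * eval_form S \<beta> X"
proof -
  have prod: "pairing S (\<lambda>a b. \<alpha> [a] * \<beta> [b]) X Y = eval_form S \<alpha> X * eval_form S \<beta> Y" for \<alpha> \<beta>
    unfolding pairing_def eval_form_def sum_product by (simp add: mult_ac)
  have swap: "(\<lambda>a b. \<alpha> [b] * \<beta> [a]) = (\<lambda>a b. \<beta> [a] * \<alpha> [b])"
    by (simp add: mult.commute)
  show ?thesis
    unfolding wedge_apply[OF assms] pairing_diff swap prod by (simp add: mult.commute)
qed

lemma pairing_coord_vf:
  assumes "finite S" "a \<in> S"
  shows "pairing S \<phi> (coord_vf a) Y = (\<Sum>b\<in>S. \<phi> a b * Y b)"
proof -
  have "pairing S \<phi> (coord_vf a) Y = (\<Sum>c\<in>S. if c = a then (\<Sum>b\<in>S. \<phi> a b * Y b) else 0)"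
    unfolding pairing_def
  proof (intro sum.cong refl)
    fix c
    have "coord_vf a c = (if c = a then 1 else 0)"
      by (auto simp: coord_vf_def fun_eq_iff)
    then show "(\<Sum>b\<in>S. \<phi> c b * coord_vf a c * Y b) = (if c = a then (\<Sum>b\<in>S. \<phi> a b * Y b) else 0)"
      by simp
  qed
  then show ?thesis using assms by simp
qed

lemma sum_coords_upto:
  "(\<Sum>a\<in>coords_upto N. g a) = g Z + g Zbar + g U + (\<Sum>i\<le>N. g (Ui i)) + (\<Sum>i\<le>N. g (Uibar i))"
  for g :: "coord \<Rightarrow> 'a :: comm_monoid_add"
proof -
  have "(\<Sum>a\<in>coords_upto N. g a) = (\<Sum>a\<in>{Z, Zbar, U} \<union> Ui ` {..N}. g a) + (\<Sum>a\<in>Uibar ` {..N}. g a)"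
    unfolding coords_upto_def by (intro sum.union_disjoint) auto
  also have "(\<Sum>a\<in>{Z, Zbar, U} \<union> Ui ` {..N}. g a) = (\<Sum>a\<in>{Z, Zbar, U}. g a) + (\<Sum>a\<in>Ui ` {..N}. g a)"
    by (intro sum.union_disjoint) auto
  finally show ?thesis
    by (simp add: sum.reindex inj_on_def add.assoc)
qed

lemma mem_coords_upto [simp]:
  "Z \<in> coords_upto N" "Zbar \<in> coords_upto N" "U \<in> coords_upto N"
  "Ui i \<in> coords_upto N \<longleftrightarrow> i \<le> N" "Uibar i \<in> coords_upto N \<longleftrightarrow> i \<le> N"
  by (auto simp: coords_upto_def)

lemma eta_0: "eta f 0 = dcoord U - uj 0 \<cdot> dcoord Z - cnj_fun (uj 0) \<cdot> dcoord Zbar"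
  and eta_Suc: "eta f (Suc i) = dcoord (Ui i) + T f i \<cdot> dcoord Zbar - uj (Suc i) \<cdot> dcoord Z"
  by (simp_all add: eta_def omega_def zeta_def cnj_form_dcoord cnj_fun_def)

lemma eval_eta:
  "eval_form (coords_upto N) (eta f 0) X = X U - uj 0 * X Z - cnj_fun (uj 0) * X Zbar"
  "i \<le> N \<Longrightarrow> eval_form (coords_upto N) (eta f (Suc i)) X = X (Ui i) + T f i * X Zbar - uj (Suc i) * X Z"
  "i \<le> N \<Longrightarrow> eval_form (coords_upto N) (cnj_form (eta f (Suc i))) X
      = X (Uibar i) + cnj_fun (T f i) * X Z - cnj_fun (uj (Suc i)) * X Zbar"
  by (simp_all add: eta_0 eta_Suc eval_form_add eval_form_diff eval_form_smult eval_form_dcoord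
      cnj_form_add cnj_form_diff cnj_form_smult cnj_form_dcoord)

lemma eval_zeta_omega:
  "eval_form (coords_upto N) zeta X = X Z"
  "eval_form (coords_upto N) (cnj_form zeta) X = X Zbar"
  "eval_form (coords_upto N) (omega f 1) X = X (Ui 0) + T f 0 * X Zbar"
  "eval_form (coords_upto N) (cnj_form (omega f 1)) X = X (Uibar 0) + cnj_fun (T f 0) * X Z"
  by (simp_all add: omega_def zeta_def eval_form_add eval_form_diff eval_form_smult eval_form_dcoord
      cnj_form_add cnj_form_diff cnj_form_smult cnj_form_dcoord del: T.simps(1))

lemma frame_values:
  "e_m1 f Z = 1" "e_m1 f Zbar = 0" "e_m1 f U = uj 0" "e_m1 f (Ui i) = uj (Suc i)" "e_m1 f (Uibar i) = - cnj_fun (T f i)"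
  "cnj_vf (e_m1 f) Z = 0" "cnj_vf (e_m1 f) Zbar = 1" "cnj_vf (e_m1 f) U = cnj_fun (uj 0)"
  "cnj_vf (e_m1 f) (Ui i) = - T f i" "cnj_vf (e_m1 f) (Uibar i) = cnj_fun (uj (Suc i))"
  by (auto simp: cnj_vf_def cnj_fun_def fun_eq_iff)

declare e_m1.simps [simp del]

text \<open>Frame and coframe are dual. Cutting off at N costs nothing: the component u_(N+1) of E
  along \<open>Ui N\<close> cancels against the same entry of \<eta>_(N+1).\<close>

lemma coframe_expansion:
  assumes \<alpha>: "form_on n \<alpha>" "has_degree 1 \<alpha>" and "n \<le> N"
  shows "\<alpha> as = (\<Sum>a\<in>coords_upto N. eval_form (coords_upto N) \<alpha> (frame f a) * coframe f a as)"
proof (cases "length as = 1")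
  case False
  have "has_degree 1 (coframe f a)" for a
    by (cases a; simp only: coframe.simps) (intro has_degree_zeta has_degree_cnj has_degree_eta)+
  then show ?thesis by (simp only: has_degreeD[OF _ False] \<alpha>(2) mult_zero_right sum.neutral_const)
next
  case True
  then obtain x where x: "as = [x]" by (auto simp: length_Suc_conv)
  let ?S = "coords_upto N"
  have E: "eval_form ?S \<alpha> (e_m1 f) = \<alpha> [Z] + \<alpha> [U] * uj 0 + (\<Sum>i\<le>N. \<alpha> [Ui i] * uj (Suc i))
      - (\<Sum>i\<le>N. \<alpha> [Uibar i] * cnj_fun (T f i))"
    by (simp add: eval_form_def sum_coords_upto frame_values sum_negf)
  have Ebar: "eval_form ?S \<alpha> (cnj_vf (e_m1 f)) = \<alpha> [Zbar] + \<alpha> [U] * cnj_fun (uj 0)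
      - (\<Sum>i\<le>N. \<alpha> [Ui i] * T f i) + (\<Sum>i\<le>N. \<alpha> [Uibar i] * cnj_fun (uj (Suc i)))"
    by (simp add: eval_form_def sum_coords_upto frame_values sum_negf)
  have dc: "dcoord a [b] = (if b = a then 1 else 0)" for a b
    by (auto simp: dcoord_def fun_eq_iff)
  have co: "coframe f U = eta f 0" "coframe f (Ui i) = eta f (Suc i)"
    "coframe f (Uibar i) = cnj_form (eta f (Suc i))" for i by simp_all
  note dual = eta_0 eta_Suc cnj_form_add cnj_form_diff cnj_form_smult cnj_form_dcoord smult_form_apply dc
  have zero: "\<alpha> [x] = 0" if "x \<notin> ?S"
  proof -
    have "\<not> set [x] \<subseteq> coords_upto n" using that coords_upto_mono[OF assms(3)] by auto
    then show ?thesis using \<alpha>(1) unfolding form_on_def by (auto simp: fun_eq_iff)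
  qed
  have delta: "(\<Sum>i\<le>N. \<alpha> [g i] * (if g l = g i then 1 else 0)) = (if l \<le> N then \<alpha> [g l] else 0)"
    if "inj g" for g :: "nat \<Rightarrow> coord" and l
  proof -
    have "(\<Sum>i\<le>N. \<alpha> [g i] * (if g l = g i then 1 else 0)) = (\<Sum>i\<le>N. if i = l then \<alpha> [g l] else 0)"
      by (intro sum.cong refl) (use that in \<open>auto simp: inj_def\<close>)
    then show ?thesis by simp
  qed
  have inj: "inj Ui" "inj Uibar" by (auto simp: inj_def)
  show ?thesis
    unfolding x
  proof (cases x)
    case (Ui l)
    then show "\<alpha> [x] = (\<Sum>a\<in>?S. eval_form ?S \<alpha> (frame f a) * coframe f a [x])"
      using zero delta[OF inj(1), of l]
      by (simp add: sum_coords_upto eval_form_coord_vf dual zeta_def)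
  next
    case (Uibar l)
    then show "\<alpha> [x] = (\<Sum>a\<in>?S. eval_form ?S \<alpha> (frame f a) * coframe f a [x])"
      using zero delta[OF inj(2), of l]
      by (simp add: sum_coords_upto eval_form_coord_vf dual zeta_def)
  qed (simp_all add: sum_coords_upto eval_form_coord_vf dual zeta_def E Ebar algebra_simps sum_negf)
qed

subsection \<open>Brackets of the frame fields\<close>

lemma pairing_uminus_left: "pairing S \<phi> (- X) Y = - pairing S \<phi> X Y"
  by (simp add: pairing_def sum_negf)

lemma pairing_eq_0:
  "(\<And>a b. a \<in> S \<Longrightarrow> b \<in> S \<Longrightarrow> \<phi> a b = 0 \<or> X a = 0 \<or> Y b = 0) \<Longrightarrow> pairing S \<phi> X Y = 0"
  unfolding pairing_def by (intro sum.neutral ballI) force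

lemma pairing_coord_vf_coord_vf:
  assumes "finite S" "a \<in> S" "b \<in> S"
  shows "pairing S \<phi> (coord_vf a) (coord_vf b) = \<phi> a b"
proof -
  have "\<phi> a c * coord_vf b c = (if c = b then \<phi> a b else 0)" for c
    by (auto simp: coord_vf_def fun_eq_iff)
  then show ?thesis using assms by (simp add: pairing_coord_vf)
qed

lemma bracket_coord_vf_coord_vf: "bracket S (coord_vf a) (coord_vf b) = 0"
  by (simp add: bracket_def fun_eq_iff)

lemma smooth_cnj_fun [smooth]: "smooth_fun_inf F \<Longrightarrow> smooth_fun_inf (cnj_fun F)"
  unfolding cnj_fun_def by (rule smooth)

lemma partial_cnj_fun: "smooth_fun_inf F \<Longrightarrow> partial a (cnj_fun F) = cnj_fun (partial (bar a) F)"
  by (simp add: cnj_fun_def partial_cnj)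

lemma cnj_fun_simps [simp]:
  "cnj_fun (F + G) = cnj_fun F + cnj_fun G" "cnj_fun (F * G) = cnj_fun F * cnj_fun G"
  "cnj_fun (- F) = - cnj_fun F" "cnj_fun 0 = 0" "cnj_fun 1 = 1" "cnj_fun (\<lambda>p. c) = (\<lambda>p. cnj c)"
  by (auto simp: cnj_fun_def fun_eq_iff)

lemma cnj_T_0: "cnj_fun (T f 0) = T f 0"
  by (auto simp: cnj_fun_def)

context
  fixes f :: "real \<Rightarrow> real" and N :: nat
  assumes f: "smooth_real f"
begin

text \<open>The coordinate u_0 occurs in E only as the component along u: the components along
  conjugates of the u_l are conjugates of T^l and hence independent of u_0.\<close>

lemma bracket_E_Ui_0: "bracket (coords_upto N) (e_m1 f) (coord_vf (Ui 0)) = - coord_vf U"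
proof
  fix b
  have "- partial (Ui 0) (e_m1 f b) = (- coord_vf U) b"
    using f
    by (cases b) (auto simp: frame_values partial_uj partial_uminus partial_cnj_fun smooth coord_vf_def
      partial_T_eq_0 image_iff one_fun_def zero_fun_def)
  then show "bracket (coords_upto N) (e_m1 f) (coord_vf (Ui 0)) b = (- coord_vf U) b"
    by (simp add: bracket_coord_vf)
qed

lemma bracket_E_Ui_Suc:
  "Suc i \<le> N \<Longrightarrow> bracket (coords_upto N) (e_m1 f) (coord_vf (Ui (Suc i))) = - coord_vf (Ui i)"
proof
  fix b assume i: "Suc i \<le> N"
  have "- partial (Ui (Suc i)) (e_m1 f b) = (- coord_vf (Ui i)) b"
    using f
    by (cases b) (auto simp: frame_values partial_uj partial_uminus partial_cnj_fun smooth coord_vf_def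
      partial_T_eq_0 image_iff one_fun_def zero_fun_def)
  then show "bracket (coords_upto N) (e_m1 f) (coord_vf (Ui (Suc i))) b = (- coord_vf (Ui i)) b"
    using i by (simp add: bracket_coord_vf)
qed

text \<open>Since this bracket lies in the conjugate directions, pairing it with a holomorphic
  direction produces mixed coefficients only.\<close>

lemma bracket_E_Uibar:
  assumes "i \<le> N"
  shows "bracket (coords_upto N) (e_m1 f) (coord_vf (Uibar i)) b
    = (case b of Uibar l \<Rightarrow> cnj_fun (partial (Ui i) (T f l)) | _ \<Rightarrow> 0)"
  using assms f by (cases b) (simp_all add: bracket_coord_vf frame_values partial_uj partial_uminus partial_cnj_fun smooth)

lemma bracket_E_U:
  "bracket (coords_upto N) (e_m1 f) (coord_vf U) b
    = (case b of Uibar l \<Rightarrow> cnj_fun (partial U (T f l)) | _ \<Rightarrow> 0)"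
  using f by (cases b) (simp_all add: bracket_coord_vf frame_values partial_uj partial_uminus partial_cnj_fun smooth)

lemma bracket_Ebar_Uibar_0: "bracket (coords_upto N) (cnj_vf (e_m1 f)) (coord_vf (Uibar 0)) = - coord_vf U"
proof
  fix b
  have "- partial (Uibar 0) (cnj_vf (e_m1 f) b) = (- coord_vf U) b"
    using f
    by (cases b) (auto simp: frame_values partial_uj partial_uminus partial_cnj_fun smooth coord_vf_def
      partial_T_eq_0 image_iff one_fun_def zero_fun_def)
  then show "bracket (coords_upto N) (cnj_vf (e_m1 f)) (coord_vf (Uibar 0)) b = (- coord_vf U) b"
    by (simp add: bracket_coord_vf)
qed

lemma bracket_Ebar_Ui:
  assumes "i \<le> N"
  shows "bracket (coords_upto N) (cnj_vf (e_m1 f)) (coord_vf (Ui i)) b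
    = (case b of Ui l \<Rightarrow> partial (Ui i) (T f l) | _ \<Rightarrow> 0)"
  using assms f by (cases b) (simp_all add: bracket_coord_vf frame_values partial_uj partial_uminus partial_cnj_fun smooth)

lemma bracket_Ebar_U:
  "bracket (coords_upto N) (cnj_vf (e_m1 f)) (coord_vf U) b
    = (case b of Ui l \<Rightarrow> partial U (T f l) | _ \<Rightarrow> 0)"
  using f by (cases b) (simp_all add: bracket_coord_vf frame_values partial_uj partial_uminus partial_cnj_fun smooth)

text \<open>Index N is excluded: E' applied to u_(N+1) would need a coordinate outside
  \<open>coords_upto N\<close>. For smaller indices the two derivatives cancel by E T^i = T^(i+1)
  and its conjugate, and in direction u because f is real.\<close>

lemma bracket_E_Ebar:
  assumes "b \<in> coords_upto n" "n < N"
  shows "bracket (coords_upto N) (e_m1 f) (cnj_vf (e_m1 f)) b = 0"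
proof -
  let ?S = "coords_upto N" and ?E = "e_m1 f" and ?Eb = "cnj_vf (e_m1 f)"
  have cnj: "deriv_on ?S ?Eb (cnj_fun F) = cnj_fun (deriv_on ?S ?E F)" if "smooth_fun_inf F" for F
    using deriv_on_cnj[OF that bar_coords_upto] by (simp add: cnj_fun_def)
  have uj: "deriv_on ?S X (uj l) = X (Ui l)" if "l \<le> N" for l X
  proof -
    have "X a * partial a (uj l) = (if a = Ui l then X (Ui l) else 0)" for a
      by (auto simp: partial_uj)
    then show ?thesis using that by (simp add: deriv_on_def)
  qed
  have ujbar: "deriv_on ?S X (cnj_fun (uj l)) = X (Uibar l)" if "l \<le> N" for l X
  proof -
    have "X a * partial a (cnj_fun (uj l)) = (if a = Uibar l then X (Uibar l) else 0)" for a
      by (cases a) (auto simp: partial_cnj_fun partial_uj smooth)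
    then show ?thesis using that by (simp add: deriv_on_def)
  qed
  have T: "deriv_on ?S ?E (- T f i) = - T f (Suc i)"
    "deriv_on ?S ?Eb (- cnj_fun (T f i)) = - cnj_fun (T f (Suc i))" if "i \<le> N" for i
    using f that by (simp_all add: deriv_on_uminus smooth deriv_on_T cnj)
  have c: "deriv_on ?S X 1 = 0" for X by (simp add: deriv_on_def)
  show ?thesis
    using assms
    by (cases b) (simp_all add: bracket_def frame_values c T uj ujbar cnj_T_0 fun_eq_iff del: T.simps(1))
qed

end

subsection \<open>The normal form of a closed two-form\<close>

lemma eta_entries:
  "eta f 0 [U] = 1" "eta f 0 [Ui l] = 0" "eta f 0 [Uibar l] = 0"
  "zeta [U] = 0" "zeta [Ui l] = 0" "zeta [Uibar l] = 0"
  "cnj_form zeta [U] = 0" "cnj_form zeta [Ui l] = 0" "cnj_form zeta [Uibar l] = 0"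
  by (auto simp: eta_0 smult_form_def dcoord_def zeta_def cnj_form_def fun_eq_iff)

lemma eta_entries_pos:
  assumes "1 \<le> i"
  shows "eta f i [U] = 0" "eta f i [Ui l] = (if i = Suc l then 1 else 0)" "eta f i [Uibar l] = 0"
    "cnj_form (eta f i) [U] = 0" "cnj_form (eta f i) [Ui l] = 0"
    "cnj_form (eta f i) [Uibar l] = (if i = Suc l then 1 else 0)"
proof -
  obtain n where "i = Suc n" using assms by (cases i) auto
  then show "eta f i [U] = 0" "eta f i [Ui l] = (if i = Suc l then 1 else 0)" "eta f i [Uibar l] = 0"
    "cnj_form (eta f i) [U] = 0" "cnj_form (eta f i) [Ui l] = 0"
    "cnj_form (eta f i) [Uibar l] = (if i = Suc l then 1 else 0)"
    by (auto simp: eta_Suc smult_form_def dcoord_def cnj_form_def fun_eq_iff)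
qed

locale closed_normal_form =
  fixes f :: "real \<Rightarrow> real" and k :: nat and \<Phi> \<rho> :: form
    and A :: "point \<Rightarrow> complex" and B D :: "nat \<Rightarrow> nat \<Rightarrow> point \<Rightarrow> complex"
  assumes f: "smooth_real f"
    and form_on: "form_on k \<Phi>" and real: "cnj_form \<Phi> = \<Phi>" and closed: "ext_d \<Phi> = 0"
    and normal: "normal_form f k \<Phi> \<rho> A B D"
    and rho_U: "interior_prod (coord_vf U) \<rho> = 0"
begin

abbreviation \<phi> :: "coord \<Rightarrow> coord \<Rightarrow> point \<Rightarrow> complex" where "\<phi> a b \<equiv> \<Phi> [a, b]"
abbreviation E :: vfield where "E \<equiv> e_m1 f"
abbreviation Ebar :: vfield where "Ebar \<equiv> cnj_vf (e_m1 f)"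

text \<open>The factor coming from \<open>Im_form\<close> in \<open>psi\<close>.\<close>

definition h :: "point \<Rightarrow> complex" where "h = (\<lambda>p. 1 / (2 * \<i>))"

lemma degree_rho: "has_degree 1 \<rho>" and smooth_A [smooth]: "smooth_fun_inf A" and cnj_A: "cnj_fun A = A"
  using normal by (auto simp: normal_form_def cnj_fun_def fun_eq_iff Reals_cnj_iff)

lemma smooth_phi [smooth]: "smooth_fun_inf (\<phi> a b)"
  using form_on unfolding form_on_def smooth_fun_inf_def by blast

lemma smooth_h [smooth]: "smooth_fun_inf h"
  unfolding h_def by (rule smooth)

lemma smooth_E [smooth]: "smooth_fun_inf (E a)" and smooth_Ebar [smooth]: "smooth_fun_inf (Ebar a)"
  using f by (auto intro: smooth)

lemma phi_flip: "\<phi> a b = - \<phi> b a"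
proof
  have "\<Phi> ([] @ a # b # []) p = - \<Phi> ([] @ b # a # []) p" for p
    using form_on unfolding form_on_def by blast
  then show "\<phi> a b p = (- \<phi> b a) p" for p by simp
qed

lemma phi_outside: "a \<notin> coords_upto k \<Longrightarrow> \<phi> a b = 0" "a \<notin> coords_upto k \<Longrightarrow> \<phi> b a = 0"
  using form_on unfolding form_on_def by (auto simp: fun_eq_iff)

lemma phi_refl: "\<phi> a a = 0"
  using phi_flip[of a a] by (auto simp: fun_eq_iff eq_neg_iff_add_eq_0)

lemma phi_closed: "partial a (\<phi> b c) - partial b (\<phi> a c) + partial c (\<phi> a b) = 0"
  using closed ext_d_two_form_apply[of \<Phi> a b c] by simp

lemma cnj_phi: "cnj_fun (\<phi> a b) = \<phi> (bar a) (bar b)"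
proof -
  have "cnj_form \<Phi> [bar a, bar b] = cnj_fun (\<phi> a b)"
    by (simp add: cnj_form_def cnj_fun_def)
  then show ?thesis by (simp add: real)
qed

lemma rho_U_eq_0: "\<rho> [U] = 0"
proof -
  obtain n where n: "form_on n \<rho>" using normal by (auto simp: normal_form_def form_inf_def)
  have "interior_prod (coord_vf U) \<rho> [] = eval_form (coords_upto n) \<rho> (coord_vf U)"
    using n by (rule interior_prod_Nil) auto
  then show ?thesis using rho_U by (simp add: eval_form_coord_vf)
qed

lemma cnj_h: "cnj_fun h = - h"
  by (auto simp: h_def fun_eq_iff complex_eq_iff)

lemma h_cancel: "h * F = h * G \<longleftrightarrow> F = G"
  by (auto simp: h_def fun_eq_iff)

lemma Phi_eq:
  "\<Phi> [a, b] = (eta f 0 \<and>\<^sub>f \<rho>) [a, b]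
    + A * (h * ((zeta \<and>\<^sub>f omega f 1) [a, b] - (cnj_form zeta \<and>\<^sub>f cnj_form (omega f 1)) [a, b]))
    + (\<Sum>(i, j)\<in>{(i, j). 1 \<le> i \<and> i < j \<and> j \<le> k}.
        B i j * (eta f i \<and>\<^sub>f eta f j) [a, b]
        + cnj_fun (B i j) * (cnj_form (eta f i) \<and>\<^sub>f cnj_form (eta f j)) [a, b])
    + (\<Sum>(i, j)\<in>{(i, j). 1 \<le> i \<and> i \<le> j \<and> j \<le> k}.
        D i j * (eta f i \<and>\<^sub>f cnj_form (eta f j)) [a, b]
        + cnj_fun (D i j) * (cnj_form (eta f i) \<and>\<^sub>f eta f j) [a, b])"
proof -
  have "cnj_form (zeta \<and>\<^sub>f omega f 1) [a, b] = (cnj_form zeta \<and>\<^sub>f cnj_form (omega f 1)) [a, b]"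
  proof -
    have "cnj_form (zeta \<and>\<^sub>f omega f 1) [a, b] = cnj_fun ((zeta \<and>\<^sub>f omega f 1) [bar a, bar b])"
      by (simp add: cnj_form_def cnj_fun_def)
    also have "\<dots> = (cnj_form zeta \<and>\<^sub>f cnj_form (omega f 1)) [a, b]"
      unfolding wedge_apply[OF has_degree_zeta has_degree_omega]
        wedge_apply[OF has_degree_cnj[OF has_degree_zeta] has_degree_cnj[OF has_degree_omega]]
      by (simp add: cnj_form_def cnj_fun_def fun_eq_iff)
    finally show ?thesis .
  qed
  then have psi: "psi f [a, b] = h * ((zeta \<and>\<^sub>f omega f 1) [a, b] - (cnj_form zeta \<and>\<^sub>f cnj_form (omega f 1)) [a, b])"
    by (simp add: psi_def Im_form_def smult_form_apply h_def)
  have "\<Phi> = eta f 0 \<and>\<^sub>f \<rho> + A \<cdot> psi f + B_part f k B + D_part f k D"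
    using normal by (simp add: normal_form_def)
  then have "\<Phi> [a, b] = (eta f 0 \<and>\<^sub>f \<rho> + A \<cdot> psi f + B_part f k B + D_part f k D) [a, b]"
    by (rule arg_cong)
  then show ?thesis
    by (simp only: plus_fun_apply B_part_def D_part_def sum_fun_apply case_prod_unfold smult_form_apply psi cnj_fun_def)
qed

text \<open>E and E' lie in the kernel of \<eta>_0 and of every \<eta>_i and conjugate, so the B and
  D sums drop out and the wedge of \<eta>_0 with \<rho> contributes a single product.\<close>

lemma pairing_Phi:
  assumes "X = E \<or> X = Ebar" "k \<le> N"
  defines "S \<equiv> coords_upto N"
  shows "pairing S \<phi> X Y = - eval_form S (eta f 0) Y * eval_form S \<rho> X
    + A * (h * (eval_form S zeta X * eval_form S (omega f 1) Y - eval_form S zeta Y * eval_form S (omega f 1) X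
      - (eval_form S (cnj_form zeta) X * eval_form S (cnj_form (omega f 1)) Y
        - eval_form S (cnj_form zeta) Y * eval_form S (cnj_form (omega f 1)) X)))"
proof -
  have eta: "eval_form S (eta f i) X = 0" "eval_form S (cnj_form (eta f i)) X = 0" if i: "1 \<le> i" "i \<le> k" for i
  proof -
    obtain n where "i = Suc n" using i by (cases i) auto
    then show "eval_form S (eta f i) X = 0" "eval_form S (cnj_form (eta f i)) X = 0"
      using assms(1,2) i unfolding S_def by (auto simp: eval_eta frame_values)
  qed
  have eta0: "eval_form S (eta f 0) X = 0"
    using assms(1) unfolding S_def by (auto simp: eval_eta frame_values)
  have B0: "(\<Sum>x | 1 \<le> fst x \<and> fst x < snd x \<and> snd x \<le> k.
        B (fst x) (snd x) * pairing S (\<lambda>a b. (eta f (fst x) \<and>\<^sub>f eta f (snd x)) [a, b]) X Y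
        + cnj_fun (B (fst x) (snd x)) * pairing S (\<lambda>a b. (cnj_form (eta f (fst x)) \<and>\<^sub>f cnj_form (eta f (snd x))) [a, b]) X Y) = 0"
    by (intro sum.neutral) (auto simp: pairing_wedge has_degree_eta has_degree_cnj eta simp del: One_nat_def)
  have D0: "(\<Sum>x | 1 \<le> fst x \<and> fst x \<le> snd x \<and> snd x \<le> k.
        D (fst x) (snd x) * pairing S (\<lambda>a b. (eta f (fst x) \<and>\<^sub>f cnj_form (eta f (snd x))) [a, b]) X Y
        + cnj_fun (D (fst x) (snd x)) * pairing S (\<lambda>a b. (cnj_form (eta f (fst x)) \<and>\<^sub>f eta f (snd x)) [a, b]) X Y) = 0"
    by (intro sum.neutral) (auto simp: pairing_wedge has_degree_eta has_degree_cnj eta simp del: One_nat_def)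
  have "pairing S \<phi> X Y =
      pairing S (\<lambda>a b. (eta f 0 \<and>\<^sub>f \<rho>) [a, b]) X Y
      + A * (h * (pairing S (\<lambda>a b. (zeta \<and>\<^sub>f omega f 1) [a, b]) X Y
        - pairing S (\<lambda>a b. (cnj_form zeta \<and>\<^sub>f cnj_form (omega f 1)) [a, b]) X Y)) + 0 + 0"
    unfolding Phi_eq case_prod_unfold pairing_add pairing_smult pairing_diff pairing_sum
    unfolding B0 D0 ..
  then show ?thesis
    by (simp add: pairing_wedge[OF has_degree_eta degree_rho] pairing_wedge[OF has_degree_zeta has_degree_omega]
      pairing_wedge[OF has_degree_cnj[OF has_degree_zeta] has_degree_cnj[OF has_degree_omega]] eta0
      del: One_nat_def)
qed

lemma pairing_E:
  assumes "k \<le> N"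
  shows "pairing (coords_upto N) \<phi> E Y =
    - (Y U - uj 0 * Y Z - cnj_fun (uj 0) * Y Zbar) * eval_form (coords_upto N) \<rho> E
    + A * (h * (Y (Ui 0) + T f 0 * Y Zbar - uj (Suc 0) * Y Z))"
  unfolding pairing_Phi[OF disjI1[OF refl] assms] eval_eta eval_zeta_omega frame_values
  by (simp add: algebra_simps del: T.simps(1))

lemma pairing_Ebar:
  assumes "k \<le> N"
  shows "pairing (coords_upto N) \<phi> Ebar Y =
    - (Y U - uj 0 * Y Z - cnj_fun (uj 0) * Y Zbar) * eval_form (coords_upto N) \<rho> Ebar
    - A * (h * (Y (Uibar 0) + cnj_fun (T f 0) * Y Z - cnj_fun (uj (Suc 0)) * Y Zbar))"
  unfolding pairing_Phi[OF disjI2[OF refl] assms] eval_eta eval_zeta_omega frame_values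
  by (simp add: algebra_simps del: T.simps(1))

lemmas wedges = wedge_apply[OF has_degree_eta degree_rho] wedge_apply[OF has_degree_zeta has_degree_omega]
  wedge_apply[OF has_degree_cnj[OF has_degree_zeta] has_degree_cnj[OF has_degree_omega]]
  wedge_apply[OF has_degree_eta has_degree_eta]
  wedge_apply[OF has_degree_cnj[OF has_degree_eta] has_degree_cnj[OF has_degree_eta]]
  wedge_apply[OF has_degree_eta has_degree_cnj[OF has_degree_eta]]
  wedge_apply[OF has_degree_cnj[OF has_degree_eta] has_degree_eta]

text \<open>Among the 1-forms in the normal form other than \<rho>, only \<eta>_0 has a du
  component, and it has none along the u_j and their conjugates.\<close>

lemma phi_U: "\<phi> U (Ui j) = \<rho> [Ui j]" "\<phi> U (Uibar j) = \<rho> [Uibar j]"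
proof -
  have B0: "(\<Sum>(i, j)\<in>{(i, j). 1 \<le> i \<and> i < j \<and> j \<le> k}.
        B i j * (eta f i \<and>\<^sub>f eta f j) [U, x]
        + cnj_fun (B i j) * (cnj_form (eta f i) \<and>\<^sub>f cnj_form (eta f j)) [U, x]) = 0" for x
    unfolding wedges by (intro sum.neutral) (auto simp: eta_entries_pos)
  have D0: "(\<Sum>(i, j)\<in>{(i, j). 1 \<le> i \<and> i \<le> j \<and> j \<le> k}.
        D i j * (eta f i \<and>\<^sub>f cnj_form (eta f j)) [U, x]
        + cnj_fun (D i j) * (cnj_form (eta f i) \<and>\<^sub>f eta f j) [U, x]) = 0" for x
    unfolding wedges by (intro sum.neutral) (auto simp: eta_entries_pos)
  have omega_U: "omega f 1 [U] = 0" "cnj_form (omega f 1) [U] = 0"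
    by (auto simp: omega_def smult_form_def dcoord_def zeta_def cnj_form_def fun_eq_iff)
  show "\<phi> U (Ui j) = \<rho> [Ui j]" "\<phi> U (Uibar j) = \<rho> [Uibar j]"
    unfolding Phi_eq unfolding B0 D0 unfolding wedges eta_entries omega_U by simp_all
qed

end

section \<open>The total derivative on smooth functions\<close>

declare partial.simps [simp del]

text \<open>The order rises by one because the component of E along u_n is u_(n+1).\<close>

lemma smooth_fun_apply_vf:
  assumes "smooth_real f" "smooth_fun n F"
  shows "smooth_fun (Suc n) (apply_vf (e_m1 f) F)"
proof -
  have "smooth_fun (Suc n) (e_m1 f a)" if "a \<in> coords_upto n" for a
  proof (cases a)
    case (Uibar i)
    then have "smooth_fun (Suc n) (cnj_fun (T f i))"
      using that smooth_fun_cnj[OF smooth_fun_T[OF assms(1), of i]] unfolding cnj_fun_def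
      by (auto intro: smooth_fun_mono)
    then show ?thesis using Uibar by (simp add: frame_values smooth_fun_uminus)
  qed (use that in \<open>auto simp: frame_values intro: smooth_fun_0 smooth_fun_1 smooth_fun_mono[OF smooth_fun_uj]\<close>)
  moreover have "apply_vf (e_m1 f) F = (\<Sum>a\<in>coords_upto n. e_m1 f a * partial a F)"
    using apply_vf_eq_deriv_on[OF assms(2) order_refl] by (simp add: deriv_on_def)
  ultimately show ?thesis
    by (auto intro!: smooth_fun_sum smooth_fun_mult smooth_fun_mono[OF smooth_fun_partial[OF assms(2)]])
qed

lemma smooth_apply_vf [smooth]:
  "smooth_real f \<Longrightarrow> smooth_fun_inf F \<Longrightarrow> smooth_fun_inf (apply_vf (e_m1 f) F)"
  unfolding smooth_fun_inf_def by (blast intro: smooth_fun_apply_vf)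

lemma apply_vf_add:
  assumes "smooth_fun_inf F" "smooth_fun_inf G"
  shows "apply_vf X (F + G) = apply_vf X F + apply_vf X G"
proof -
  obtain n where n: "smooth_fun n F" "smooth_fun n G" using assms by (rule smooth_fun_inf2E)
  note eqs = apply_vf_eq_deriv_on[OF n(1) order_refl] apply_vf_eq_deriv_on[OF n(2) order_refl]
    apply_vf_eq_deriv_on[OF smooth_fun_add[OF n] order_refl]
  show ?thesis by (simp add: eqs deriv_on_add assms)
qed

lemma apply_vf_cmult:
  assumes "smooth_fun_inf F"
  shows "apply_vf X ((\<lambda>p. c) * F) = (\<lambda>p. c) * apply_vf X F"
proof -
  obtain n where n: "smooth_fun n F" using assms by (auto simp: smooth_fun_inf_def)
  note eqs = apply_vf_eq_deriv_on[OF n(1) order_refl]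
    apply_vf_eq_deriv_on[OF smooth_fun_mult[OF smooth_fun_const n] order_refl]
  show ?thesis by (simp add: eqs deriv_on_mult assms smooth)
qed

lemma apply_vf_0 [simp]: "apply_vf X 0 = 0"
  by (simp add: apply_vf_def fun_eq_iff)

lemma apply_vf_sum:
  "(\<And>i. i \<in> I \<Longrightarrow> smooth_fun_inf (F i)) \<Longrightarrow> apply_vf X (\<Sum>i\<in>I. F i) = (\<Sum>i\<in>I. apply_vf X (F i))"
proof (induction I rule: infinite_finite_induct)
  case (insert i I)
  show ?case unfolding sum.insert[OF insert.hyps(1,2)] using insert.prems
    by (subst apply_vf_add) (auto intro!: smooth insert.IH)
qed simp_all

section \<open>Coefficients of the two-form and conditions on A\<close>

context closed_normal_form
begin

lemma smooth_A_obtain: obtains n where "smooth_fun n A"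
  using smooth_A by (auto simp: smooth_fun_inf_def)

text \<open>For i < j the order of the indices in the sums leaves at most one matching summand, and
  for k \<le> i none. The shift to \<open>Suc\<close> comes from \<eta>_(i+1) being the form that
  contains du_i. Equal indices below k are left out because both summands of the D sum contribute
  there.\<close>

lemma phi_entries:
  assumes "i < j \<or> k \<le> i"
  shows "\<phi> (Ui i) (Ui j) = (if i < j \<and> j < k then B (Suc i) (Suc j) else 0)"
    "\<phi> (Ui i) (Uibar j) = (if i < j \<and> j < k then D (Suc i) (Suc j) else 0)"
proof -
  let ?PB = "{(i, j). 1 \<le> i \<and> i < j \<and> j \<le> k}" and ?PD = "{(i, j). 1 \<le> i \<and> i \<le> j \<and> j \<le> k}"
  have finite: "finite ?PB" "finite ?PD"
    by (rule finite_subset[of _ "{..k} \<times> {..k}"]; auto)+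
  have delta: "(\<Sum>x\<in>P. if x = y then g x else 0) = (if y \<in> P then g y else 0)" if "finite P"
    for P and y :: "nat \<times> nat" and g :: "nat \<times> nat \<Rightarrow> point \<Rightarrow> complex"
    using that by simp
  have B1: "(\<Sum>(m, n)\<in>?PB. B m n * (eta f m \<and>\<^sub>f eta f n) [Ui i, Ui j]
        + cnj_fun (B m n) * (cnj_form (eta f m) \<and>\<^sub>f cnj_form (eta f n)) [Ui i, Ui j])
      = (if i < j \<and> j < k then B (Suc i) (Suc j) else 0)"
  proof -
    have "(\<Sum>(m, n)\<in>?PB. B m n * (eta f m \<and>\<^sub>f eta f n) [Ui i, Ui j]
        + cnj_fun (B m n) * (cnj_form (eta f m) \<and>\<^sub>f cnj_form (eta f n)) [Ui i, Ui j])
      = (\<Sum>x\<in>?PB. if x = (Suc i, Suc j) then B (Suc i) (Suc j) else 0)"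
      unfolding wedges using assms by (intro sum.cong refl) (auto simp: eta_entries_pos)
    then show ?thesis using finite assms by (simp add: delta[where g = "\<lambda>_. B (Suc i) (Suc j)"] less_eq_Suc_le)
  qed
  have B2: "(\<Sum>(m, n)\<in>?PB. B m n * (eta f m \<and>\<^sub>f eta f n) [Ui i, Uibar j]
        + cnj_fun (B m n) * (cnj_form (eta f m) \<and>\<^sub>f cnj_form (eta f n)) [Ui i, Uibar j]) = 0"
    unfolding wedges using assms by (intro sum.neutral) (auto simp: eta_entries_pos)
  have D1: "(\<Sum>(m, n)\<in>?PD. D m n * (eta f m \<and>\<^sub>f cnj_form (eta f n)) [Ui i, Ui j]
        + cnj_fun (D m n) * (cnj_form (eta f m) \<and>\<^sub>f eta f n) [Ui i, Ui j]) = 0"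
    unfolding wedges by (intro sum.neutral) (auto simp: eta_entries_pos)
  have D2: "(\<Sum>(m, n)\<in>?PD. D m n * (eta f m \<and>\<^sub>f cnj_form (eta f n)) [Ui i, Uibar j]
        + cnj_fun (D m n) * (cnj_form (eta f m) \<and>\<^sub>f eta f n) [Ui i, Uibar j])
      = (if i < j \<and> j < k then D (Suc i) (Suc j) else 0)"
  proof -
    have "(\<Sum>(m, n)\<in>?PD. D m n * (eta f m \<and>\<^sub>f cnj_form (eta f n)) [Ui i, Uibar j]
        + cnj_fun (D m n) * (cnj_form (eta f m) \<and>\<^sub>f eta f n) [Ui i, Uibar j])
      = (\<Sum>x\<in>?PD. if x = (Suc i, Suc j) then D (Suc i) (Suc j) else 0)"
      unfolding wedges using assms by (intro sum.cong refl) (auto simp: eta_entries_pos)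
    then show ?thesis using finite assms by (auto simp: delta[where g = "\<lambda>_. D (Suc i) (Suc j)"])
  qed
  show "\<phi> (Ui i) (Ui j) = (if i < j \<and> j < k then B (Suc i) (Suc j) else 0)"
    unfolding Phi_eq unfolding B1 D1 unfolding wedges eta_entries by simp
  show "\<phi> (Ui i) (Uibar j) = (if i < j \<and> j < k then D (Suc i) (Suc j) else 0)"
    unfolding Phi_eq unfolding B2 D2 unfolding wedges eta_entries by simp
qed

text \<open>The sums stop at \<eta>_k, which contains du_(k-1), so the vanishing begins at i = k
  already; it starts the descending inductions.\<close>

lemma phi_top:
  assumes "k \<le> i"
  shows "\<phi> (Ui i) (Ui j) = 0" "\<phi> (Ui i) (Uibar j) = 0"
  unfolding phi_entries[OF disjI2[OF assms]] using assms by auto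

text \<open>The conjugate summand has the opposite orientation, so \<Phi> sees only the imaginary
  part of the diagonal coefficient; the real part stays undetermined.\<close>

lemma phi_diagonal:
  assumes "i < k"
  shows "\<phi> (Ui i) (Uibar i) = D (Suc i) (Suc i) - cnj_fun (D (Suc i) (Suc i))"
proof -
  let ?PB = "{(i, j). 1 \<le> i \<and> i < j \<and> j \<le> k}" and ?PD = "{(i, j). 1 \<le> i \<and> i \<le> j \<and> j \<le> k}"
  have finite: "finite ?PD"
    by (rule finite_subset[of _ "{..k} \<times> {..k}"]; auto)
  have B2: "(\<Sum>(m, n)\<in>?PB. B m n * (eta f m \<and>\<^sub>f eta f n) [Ui i, Uibar i]
        + cnj_fun (B m n) * (cnj_form (eta f m) \<and>\<^sub>f cnj_form (eta f n)) [Ui i, Uibar i]) = 0"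
    unfolding wedges using assms by (intro sum.neutral) (auto simp: eta_entries_pos)
  have "(\<Sum>(m, n)\<in>?PD. D m n * (eta f m \<and>\<^sub>f cnj_form (eta f n)) [Ui i, Uibar i]
        + cnj_fun (D m n) * (cnj_form (eta f m) \<and>\<^sub>f eta f n) [Ui i, Uibar i])
      = (\<Sum>x\<in>?PD. if x = (Suc i, Suc i) then D (Suc i) (Suc i) - cnj_fun (D (Suc i) (Suc i)) else 0)"
    unfolding wedges using assms by (intro sum.cong refl) (auto simp: eta_entries_pos)
  also have "\<dots> = D (Suc i) (Suc i) - cnj_fun (D (Suc i) (Suc i))"
    using finite assms by simp
  finally have D2: "(\<Sum>(m, n)\<in>?PD. D m n * (eta f m \<and>\<^sub>f cnj_form (eta f n)) [Ui i, Uibar i]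
        + cnj_fun (D m n) * (cnj_form (eta f m) \<and>\<^sub>f eta f n) [Ui i, Uibar i])
      = D (Suc i) (Suc i) - cnj_fun (D (Suc i) (Suc i))" .
  show ?thesis
    unfolding Phi_eq unfolding B2 D2 unfolding wedges eta_entries by simp
qed

lemma pairing_phi_flip: "pairing S \<phi> X Y = - pairing S \<phi> Y X"
  by (rule pairing_flip) (rule phi_flip)

lemma two_cancel: "2 * F = 0 \<longleftrightarrow> F = (0 :: point \<Rightarrow> complex)"
  by (simp add: fun_eq_iff)

lemmas identity = closed_form_identity[of \<phi>, OF phi_flip phi_closed _ _ _ smooth_phi]

lemma pairing_E_coord:
  assumes "k \<le> N"
  shows "i \<le> N \<Longrightarrow> pairing (coords_upto N) \<phi> E (coord_vf (Ui i)) = (if i = 0 then h * A else 0)"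
    "pairing (coords_upto N) \<phi> E (coord_vf (Uibar i)) = 0"
    "pairing (coords_upto N) \<phi> E (coord_vf U) = - eval_form (coords_upto N) \<rho> E"
    "pairing (coords_upto N) \<phi> E Ebar = 0"
    "i \<le> N \<Longrightarrow> pairing (coords_upto N) \<phi> Ebar (coord_vf (Uibar i)) = (if i = 0 then - h * A else 0)"
    "pairing (coords_upto N) \<phi> Ebar (coord_vf (Ui i)) = 0"
    "pairing (coords_upto N) \<phi> Ebar (coord_vf U) = - eval_form (coords_upto N) \<rho> Ebar"
  unfolding pairing_E[OF assms] pairing_Ebar[OF assms] frame_values
  by (auto simp: coord_vf_def fun_eq_iff cnj_fun_def)

text \<open>E paired with a conjugate direction gives 0, and paired with \<open>Ui i\<close> it
  gives h A for i = 0 and 0 otherwise; so A enters the mixed identities in row 0 alone.\<close>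

lemma identity_Ui_Uibar:
  assumes N: "k \<le> N" "i \<le> N" "j \<le> N"
  shows "deriv_on (coords_upto N) E (\<phi> (Ui i) (Uibar j)) + (if i = 0 then partial (Uibar j) (h * A) else 0)
    - pairing (coords_upto N) \<phi> (bracket (coords_upto N) E (coord_vf (Ui i))) (coord_vf (Uibar j))
    + pairing (coords_upto N) \<phi> (bracket (coords_upto N) E (coord_vf (Uibar j))) (coord_vf (Ui i)) = 0"
proof -
  have "pairing S \<phi> 0 X = 0" for S X by (simp add: pairing_def)
  then show ?thesis
    using identity[of E "coord_vf (Ui i)" "coord_vf (Uibar j)" "coords_upto N"] N
    by (cases "i = 0") (simp_all add: smooth pairing_coord_vf_coord_vf deriv_on_coord_vf pairing_E_coord bracket_coord_vf_coord_vf)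
qed

text \<open>By \<open>bracket_E_Uibar\<close> the pairing is a combination of mixed coefficients
  from the same row i. This keeps the descending induction on i closed, for all j at once.\<close>

lemma pairing_bracket_E_Uibar:
  assumes "j \<le> N" "i \<le> N" and "\<And>l. \<phi> (Ui i) (Uibar l) = 0"
  shows "pairing (coords_upto N) \<phi> (bracket (coords_upto N) E (coord_vf (Uibar j))) (coord_vf (Ui i)) = 0"
proof (rule pairing_eq_0)
  fix a b
  show "\<phi> a b = 0 \<or> bracket (coords_upto N) E (coord_vf (Uibar j)) a = 0 \<or> coord_vf (Ui i) b = 0"
  proof (cases "b = Ui i")
    case True
    then show ?thesis
      using assms(3) phi_flip[of a b] by (cases a) (simp_all add: bracket_E_Uibar[OF f assms(1)])
  next
    case False
    then show ?thesis by (simp add: coord_vf_def fun_eq_iff)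
  qed
qed

text \<open>If row i + 1 vanishes for all j, so do the differentiated term and the bracket with the
  conjugate field, and the bracket of E with \<open>Ui (Suc i)\<close> exposes row i.\<close>

lemma phi_Ui_Uibar: "\<phi> (Ui i) (Uibar j) = 0"
proof (cases "k \<le> i")
  case True
  then show ?thesis by (rule phi_top(2))
next
  case False
  then have "i \<le> k" by simp
  then show ?thesis
  proof (induction i arbitrary: j rule: inc_induct)
    case base
    show ?case by (rule phi_top(2)[OF order_refl])
  next
    case (step i)
    define N where "N = max (Suc k) j"
    have N: "k \<le> N" "Suc i \<le> N" "j \<le> N" using step.hyps by (auto simp: N_def)
    show ?case
      using identity_Ui_Uibar[OF N] pairing_bracket_E_Uibar[OF N(3,2) step.IH] N
      by (simp add: step.IH bracket_E_Ui_Suc[OF f] pairing_uminus_left pairing_coord_vf_coord_vf)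
  qed
qed

text \<open>Row 0 of the mixed identity: the bracket of E now yields the direction u, and the
  derivative of h A survives, so the identity gives a value instead of a vanishing.\<close>

lemma phi_U_Uibar: "\<phi> U (Uibar j) = - h * partial (Uibar j) A"
proof -
  define N where "N = max k j"
  have N: "k \<le> N" "0 \<le> N" "j \<le> N" by (auto simp: N_def)
  have "partial (Uibar j) (h * A) + \<phi> U (Uibar j) = 0"
    using identity_Ui_Uibar[OF N] pairing_bracket_E_Uibar[OF N(3,2) phi_Ui_Uibar] N
    by (simp add: phi_Ui_Uibar bracket_E_Ui_0[OF f] pairing_uminus_left pairing_coord_vf_coord_vf)
  moreover have "partial (Uibar j) (h * A) = h * partial (Uibar j) A"
    by (simp add: partial_mult smooth) (simp add: h_def)
  ultimately show ?thesis by (simp add: add_eq_0_iff)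
qed

lemma phi_U_Ui: "\<phi> U (Ui j) = h * partial (Ui j) A"
proof -
  have "cnj_fun (partial (Uibar j) A) = partial (Ui j) A"
    using partial_cnj_fun[OF smooth_A, of "Ui j"] by (simp add: cnj_A)
  then show ?thesis
    using cnj_phi[of U "Uibar j"] by (simp add: phi_U_Uibar cnj_h)
qed

lemma partial_h: "smooth_fun_inf F \<Longrightarrow> partial a (h * F) = h * partial a F"
  by (simp add: partial_mult smooth) (simp add: h_def)

lemma deriv_on_h: "smooth_fun_inf F \<Longrightarrow> deriv_on S X (h * F) = h * deriv_on S X F"
  by (simp add: deriv_on_mult smooth) (simp add: h_def)

text \<open>By \<open>cnj_h\<close> the entries \<open>\<phi> U (Ui i)\<close> and
  \<open>\<phi> U (Uibar j)\<close> carry opposite signs, so the two second derivatives add up in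
  d\<Phi> = 0 instead of cancelling.\<close>

lemma partial_Ui_Uibar_A: "partial (Uibar j) (partial (Ui i) A) = 0"
proof -
  have "h * partial (Ui i) (partial (Uibar j) A) + h * partial (Uibar j) (partial (Ui i) A) = 0"
    using phi_closed[of U "Ui i" "Uibar j"]
    by (simp add: phi_Ui_Uibar phi_U_Ui phi_U_Uibar partial_uminus partial_h smooth)
  then have "h * (2 * partial (Uibar j) (partial (Ui i) A)) = h * 0"
    unfolding partial_commute[OF smooth_A, of "Ui i"] by (simp add: algebra_simps)
  then show ?thesis unfolding h_cancel by (simp add: two_cancel)
qed

text \<open>
  \<open>h A = \<Phi>(E, \<partial>/\<partial>u\<^sub>0)\<close>, and the only component of \<open>E\<close> in this expression that is not defined on
  \<open>M\<^sup>(\<^sup>k\<^sup>)\<close> is multiplied by \<open>\<Phi>(\<partial>/\<partial>u\<^sub>k, \<partial>/\<partial>u\<^sub>0) = 0\<close>.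
\<close>

lemma smooth_fun_A: "smooth_fun k A"
proof -
  let ?S = "coords_upto k"
  have hA: "h * A = - (\<Sum>b\<in>?S. \<phi> (Ui 0) b * E b)"
    using pairing_E_coord(1)[of k 0] pairing_phi_flip[of ?S E "coord_vf (Ui 0)"]
    by (simp add: pairing_coord_vf)
  have "A p = A q" if "same_upto k p q" for p q
  proof -
    have "\<phi> (Ui 0) b p * E b p = \<phi> (Ui 0) b q * E b q" if "b \<in> ?S" for b
    proof (cases "b = Ui k")
      case True
      have "\<phi> (Ui 0) (Ui k) = 0"
        using phi_flip[of "Ui 0" "Ui k"] phi_top(1)[of k 0] by simp
      then show ?thesis using True by simp
    next
      case False
      have "smooth_fun k (E b)"
      proof (cases b)
        case (Ui i)
        then have "Suc i \<le> k" using False \<open>b \<in> ?S\<close> by auto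
        then show ?thesis using Ui by (auto simp: frame_values intro: smooth_fun_mono[OF smooth_fun_uj])
      next
        case (Uibar i)
        then have "smooth_fun k (cnj_fun (T f i))"
          using \<open>b \<in> ?S\<close> smooth_fun_cnj[OF smooth_fun_T[OF f, of i]] unfolding cnj_fun_def
          by (auto intro: smooth_fun_mono)
        then show ?thesis using Uibar by (simp add: frame_values smooth_fun_uminus)
      qed (auto simp: frame_values intro: smooth_fun_0 smooth_fun_1 smooth_fun_mono[OF smooth_fun_uj])
      moreover have "smooth_fun k (\<phi> (Ui 0) b)"
        using form_on unfolding form_on_def by blast
      ultimately show ?thesis
        using \<open>same_upto k p q\<close> by (simp add: smooth_fun_same)
    qed
    then have "(h * A) p = (h * A) q"
      unfolding hA by (simp add: sum_fun_apply)
    then show ?thesis by (simp add: h_def)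
  qed
  \<comment> \<open>In \<open>smooth_fun\<close> only the dependence clause mentions the order, so
    smoothness at some order n combines with dependence at order k.\<close>
  moreover obtain n where "smooth_fun n A" by (rule smooth_A_obtain)
  ultimately show ?thesis unfolding smooth_fun_def by blast
qed

text \<open>On E, E' and the field \<open>Uibar 0\<close> the last bracket produces \<Phi>(e_0, E) =
  \<rho>(E), and the only other surviving term is E applied to \<Phi>(E', .) = - h A. The second
  formula uses \<open>Ui 0\<close> in the same way.\<close>

lemma eval_rho_E:
  assumes "k < N"
  shows "eval_form (coords_upto N) \<rho> E = h * deriv_on (coords_upto N) E A"
    "eval_form (coords_upto N) \<rho> Ebar = - h * deriv_on (coords_upto N) Ebar A"
proof -
  let ?S = "coords_upto N"
  have N: "k \<le> N" using assms by simp
  \<comment> \<open>The truncated bracket can be nonzero only beyond the coordinates of order k,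
    where \<Phi> vanishes.\<close>
  have 0: "pairing ?S \<phi> (bracket ?S E Ebar) X = 0" for X
    by (rule pairing_eq_0) (metis phi_outside bracket_E_Ebar[OF f _ assms])
  \<comment> \<open>Here \<Phi>(E', .) picks the \<open>Uibar 0\<close> component of the bracket,
    the conjugate of a u_0-derivative of T^0 = f(u).\<close>
  have 1: "pairing ?S \<phi> (bracket ?S E (coord_vf (Uibar 0))) Ebar = 0"
    unfolding pairing_phi_flip[of _ _ Ebar] unfolding pairing_Ebar[OF N] unfolding bracket_E_Uibar[OF f le0]
    by (simp add: partial_T_eq_0[OF f] del: T.simps(1))
  have 2: "pairing ?S \<phi> (bracket ?S Ebar (coord_vf (Ui 0))) E = 0"
    unfolding pairing_phi_flip[of _ _ E] unfolding pairing_E[OF N] unfolding bracket_Ebar_Ui[OF f le0]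
    by (simp add: partial_T_eq_0[OF f] del: T.simps(1))
  have U: "pairing ?S \<phi> (- coord_vf U) X = - (- pairing ?S \<phi> X (coord_vf U))" for X
    unfolding pairing_uminus_left pairing_phi_flip[of _ "coord_vf U" X] ..
  show "eval_form ?S \<rho> E = h * deriv_on ?S E A"
    using identity[of E Ebar "coord_vf (Uibar 0)" ?S]
    by (simp add: smooth deriv_on_coord_vf pairing_E_coord[OF N] 0 1 bracket_Ebar_Uibar_0[OF f] U
      deriv_on_uminus deriv_on_h)
  show "eval_form ?S \<rho> Ebar = - h * deriv_on ?S Ebar A"
    using identity[of E Ebar "coord_vf (Ui 0)" ?S]
    by (simp add: smooth deriv_on_coord_vf pairing_E_coord[OF N] 0 2 bracket_E_Ui_0[OF f] U
      deriv_on_uminus deriv_on_h add_eq_0_iff)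
qed

text \<open>A_u arises twice with the same sign: from differentiating \<Phi>(E, e_1) = h A, and from
  exchanging E with the u_0-derivative in \<rho>(E) = h E A.\<close>

lemma partial_U_A: "partial U A = 0"
proof -
  define N where "N = Suc k"
  have N: "k \<le> N" "k < N" by (auto simp: N_def)
  let ?S = "coords_upto N"
  have 1: "pairing ?S \<phi> (bracket ?S E (coord_vf U)) (coord_vf (Ui 0)) = 0"
  proof (rule pairing_eq_0)
    fix a b
    show "\<phi> a b = 0 \<or> bracket ?S E (coord_vf U) a = 0 \<or> coord_vf (Ui 0) b = 0"
    proof (cases "b = Ui 0")
      case True
      then show ?thesis
        using phi_Ui_Uibar phi_flip[of a b] by (cases a) (simp_all add: bracket_E_U[OF f])
    next
      case False
      then show ?thesis by (simp add: coord_vf_def fun_eq_iff)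
    qed
  qed
  have zero: "pairing S \<phi> 0 X = 0" for S X by (simp add: pairing_def)
  have r: "deriv_on ?S E (\<phi> U (Ui 0)) = h * deriv_on ?S E (partial (Ui 0) A)"
    unfolding phi_U_Ui by (rule deriv_on_h) (intro smooth)
  have 2: "h * deriv_on ?S E (partial (Ui 0) A) - h * partial U A - h * partial (Ui 0) (deriv_on ?S E A) = 0"
    using identity[of E "coord_vf U" "coord_vf (Ui 0)" ?S]
    by (simp add: smooth deriv_on_coord_vf pairing_coord_vf_coord_vf pairing_E_coord[OF N(1)] 1
      bracket_E_Ui_0[OF f] bracket_coord_vf_coord_vf zero pairing_uminus_left phi_refl r
      eval_rho_E[OF N(2)] partial_uminus partial_h deriv_on_h flip: zero_fun_def)
  have 3: "partial (Ui 0) (deriv_on ?S E A) = partial U A + deriv_on ?S E (partial (Ui 0) A)"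
  proof -
    have "deriv_on ?S (- coord_vf U) A = - deriv_on ?S (coord_vf U) A"
      by (simp add: deriv_on_def sum_negf)
    then have 4: "deriv_on ?S E (partial (Ui 0) A) - partial (Ui 0) (deriv_on ?S E A) = - partial U A"
      using deriv_on_commutator[of E "coord_vf (Ui 0)" A ?S]
      by (simp add: smooth deriv_on_coord_vf bracket_E_Ui_0[OF f])
    have "partial (Ui 0) (deriv_on ?S E A) = deriv_on ?S E (partial (Ui 0) A)
        - (deriv_on ?S E (partial (Ui 0) A) - partial (Ui 0) (deriv_on ?S E A))"
      by simp
    then show ?thesis unfolding 4 by (simp add: add.commute)
  qed
  have "- (h * (2 * partial U A)) = h * 0"
    using 2 unfolding 3 by (simp add: algebra_simps)
  then have "h * (2 * partial U A) = h * 0" by simp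
  then show ?thesis unfolding h_cancel by (simp add: two_cancel)
qed

text \<open>The brackets of E and E' with the u direction have component f_u along
  \<open>Uibar 0\<close> and \<open>Ui 0\<close>, and each contributes h f_u A; the two orders of E
  and E' on A also contribute equally. The identity is 2 h times the equation.\<close>

lemma determining_equation:
  "apply_vf Ebar (apply_vf E A) p + of_real (deriv f (uval p)) * A p = 0"
proof -
  define N where "N = Suc k"
  have N: "k \<le> N" "k < N" by (auto simp: N_def)
  let ?S = "coords_upto N"
  have 0: "pairing ?S \<phi> (bracket ?S E Ebar) X = 0" for X
    by (rule pairing_eq_0) (metis phi_outside bracket_E_Ebar[OF f _ N(2)])
  have T0: "partial U (T f 0) = (\<lambda>p. of_real (deriv f (uval p)))"
    using partial_uval[OF f, of U] by simp
  have f': "cnj_fun (partial U (T f 0)) = partial U (T f 0)"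
    unfolding T0 by (simp add: cnj_fun_def)
  have 1: "pairing ?S \<phi> (bracket ?S E (coord_vf U)) Ebar = h * A * partial U (T f 0)"
    unfolding pairing_phi_flip[of _ _ Ebar] unfolding pairing_Ebar[OF N(1)] unfolding bracket_E_U[OF f]
    by (simp add: f' mult_ac del: T.simps(1))
  have 2: "pairing ?S \<phi> (bracket ?S Ebar (coord_vf U)) E = - (h * A * partial U (T f 0))"
    unfolding pairing_phi_flip[of _ _ E] unfolding pairing_E[OF N(1)] unfolding bracket_Ebar_U[OF f]
    by (simp add: mult_ac del: T.simps(1))
  have "h * deriv_on ?S E (deriv_on ?S Ebar A) + h * deriv_on ?S Ebar (deriv_on ?S E A)
      + 2 * (h * A * partial U (T f 0)) = 0"
    using identity[of E Ebar "coord_vf U" ?S]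
    by (simp add: smooth deriv_on_coord_vf pairing_E_coord[OF N(1)] 0 1 2 eval_rho_E[OF N(2)]
      deriv_on_h deriv_on_uminus algebra_simps del: T.simps(1))
  \<comment> \<open>A has order k < N, so the failure of [E, E'] = 0 in the top components is
    invisible.\<close>
  moreover have "deriv_on ?S E (deriv_on ?S Ebar A) = deriv_on ?S Ebar (deriv_on ?S E A)"
  proof -
    have "bracket ?S E Ebar a * partial a A = 0" for a
      using bracket_E_Ebar[OF f _ N(2)] partial_zero[OF smooth_fun_A] by (cases "a \<in> coords_upto k") auto
    then have "deriv_on ?S (bracket ?S E Ebar) A = 0"
      by (simp add: deriv_on_def)
    then show ?thesis
      using deriv_on_commutator[of E Ebar A ?S] by (simp add: smooth)
  qed
  ultimately have "h * (2 * (deriv_on ?S Ebar (deriv_on ?S E A) + partial U (T f 0) * A)) = h * 0"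
    by (simp add: algebra_simps del: T.simps(1))
  then have "deriv_on ?S Ebar (deriv_on ?S E A) + partial U (T f 0) * A = 0"
    unfolding h_cancel two_cancel .
  moreover have "deriv_on ?S E A = apply_vf E A"
    using apply_vf_eq_deriv_on[OF smooth_fun_A, of ?S] coords_upto_mono[OF N(1)] by simp
  \<comment> \<open>The choice N = k + 1 matches the order of E A.\<close>
  moreover have "deriv_on ?S Ebar (apply_vf E A) = apply_vf Ebar (apply_vf E A)"
    using apply_vf_eq_deriv_on[OF smooth_fun_apply_vf[OF f smooth_fun_A], of ?S] by (simp add: N_def)
  ultimately have "apply_vf Ebar (apply_vf E A) + partial U (T f 0) * A = 0"
    by simp
  then show ?thesis
    unfolding T0 by (simp add: fun_eq_iff)
qed

section \<open>Recursion for the holomorphic coefficients and its solution\<close>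

lemma smooth_fun_phi: "smooth_fun k (\<phi> a b)"
  using form_on unfolding form_on_def by blast

lemma two_h: "2 * h = (\<lambda>p. - \<i>)"
  by (auto simp: h_def fun_eq_iff)

text \<open>Row 0 has a source made of two equal halves, h times the u_(j+1)-derivative of A: one
  from differentiating \<Phi>(E, e_1) = h A, one from [E, e_1] = - e_0 and \<open>phi_U_Ui\<close>.
  Together they have coefficient 2 h = - \<i>. In the other rows both brackets merely shift
  indices.\<close>

lemma phi_Ui_Ui_recursion:
  "\<phi> (Ui 0) (Ui j) = - apply_vf E (\<phi> (Ui 0) (Ui (Suc j))) + (\<lambda>p. \<i>) * partial (Ui (Suc j)) A"
  "\<phi> (Ui (Suc i)) (Ui j) = - apply_vf E (\<phi> (Ui (Suc i)) (Ui (Suc j))) - \<phi> (Ui i) (Ui (Suc j))"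
proof -
  define N where "N = max (Suc k) (max (Suc i) (Suc j))"
  have N: "k \<le> N" "Suc i \<le> N" "Suc j \<le> N" "i \<le> N" "j \<le> N" by (auto simp: N_def)
  let ?S = "coords_upto N"
  have zero: "pairing S \<phi> 0 X = 0" for S X by (simp add: pairing_def)
  have ap: "apply_vf E (\<phi> a b) = deriv_on ?S E (\<phi> a b)" for a b
    using apply_vf_eq_deriv_on[OF smooth_fun_phi, of ?S] coords_upto_mono[OF N(1)] by simp
  have "deriv_on ?S E (\<phi> (Ui 0) (Ui (Suc j))) + h * partial (Ui (Suc j)) A
      + \<phi> U (Ui (Suc j)) - \<phi> (Ui j) (Ui 0) = 0"
    using identity[of E "coord_vf (Ui 0)" "coord_vf (Ui (Suc j))" ?S] N
    by (simp add: smooth deriv_on_coord_vf pairing_coord_vf_coord_vf pairing_E_coord[OF N(1)]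
      bracket_E_Ui_0[OF f] bracket_E_Ui_Suc[OF f] bracket_coord_vf_coord_vf zero pairing_uminus_left partial_h)
  then have "deriv_on ?S E (\<phi> (Ui 0) (Ui (Suc j))) + (2 * h) * partial (Ui (Suc j)) A + \<phi> (Ui 0) (Ui j) = 0"
    unfolding phi_U_Ui phi_flip[of "Ui j" "Ui 0"] by (simp add: algebra_simps)
  then show "\<phi> (Ui 0) (Ui j) = - apply_vf E (\<phi> (Ui 0) (Ui (Suc j))) + (\<lambda>p. \<i>) * partial (Ui (Suc j)) A"
    unfolding ap two_h by (simp add: fun_eq_iff add_eq_0_iff)
  have "deriv_on ?S E (\<phi> (Ui (Suc i)) (Ui (Suc j)))
      + \<phi> (Ui i) (Ui (Suc j)) - \<phi> (Ui j) (Ui (Suc i)) = 0"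
    using identity[of E "coord_vf (Ui (Suc i))" "coord_vf (Ui (Suc j))" ?S] N
    by (simp add: smooth deriv_on_coord_vf pairing_coord_vf_coord_vf pairing_E_coord[OF N(1)]
      bracket_E_Ui_Suc[OF f] bracket_coord_vf_coord_vf zero pairing_uminus_left)
  then show "\<phi> (Ui (Suc i)) (Ui j) = - apply_vf E (\<phi> (Ui (Suc i)) (Ui (Suc j))) - \<phi> (Ui i) (Ui (Suc j))"
    unfolding ap phi_flip[of "Ui j" "Ui (Suc i)"] by (simp add: fun_eq_iff) (simp add: algebra_simps eq_neg_iff_add_eq_0)
qed

definition DA :: "nat \<Rightarrow> nat \<Rightarrow> point \<Rightarrow> complex" where
  "DA m l = (apply_vf E ^^ m) (partial (Ui l) A)"

lemma smooth_DA [smooth]: "smooth_fun_inf (DA m l)"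
  unfolding DA_def using f by (induction m) (auto intro: smooth)

lemma apply_vf_DA: "apply_vf E (DA m l) = DA (Suc m) l"
  by (simp add: DA_def)

text \<open>The coefficients satisfy c(i, m) = - c(i, m - 1) - c(i - 1, m), which is Pascal's rule
  up to sign, with c(0, m) = \<i> (-1)^m from row 0. The induction on k - j lets i vary because the
  recursion passes from (i, j) to (i - 1, j + 1).\<close>

lemma phi_Ui_Ui:
  "\<phi> (Ui i) (Ui j) = (\<Sum>m<k - (i + j). (\<lambda>p. \<i> * (-1) ^ (m + i) * of_nat ((m + i) choose i)) * DA m (m + i + j + 1))"
proof (induction "k - j" arbitrary: i j)
  case 0
  then show ?case using phi_flip[of "Ui i" "Ui j"] phi_top(1)[of j i] by simp
next
  case (Suc n)
  let ?c = "\<lambda>i m. (\<lambda>p::point. \<i> * (-1) ^ (m + i) * of_nat ((m + i) choose i)) :: point \<Rightarrow> complex"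
  have IH: "\<phi> (Ui i) (Ui (Suc j)) = (\<Sum>m<k - Suc (i + j). ?c i m * DA m (m + i + Suc j + 1))" for i
    using Suc.hyps(1)[of "Suc j" i] Suc.hyps(2) by simp
  have E: "apply_vf E (\<phi> (Ui i) (Ui (Suc j))) = (\<Sum>m<k - Suc (i + j). ?c i m * DA (Suc m) (Suc m + i + j + 1))" for i
    unfolding IH by (subst apply_vf_sum) (auto simp: apply_vf_cmult apply_vf_DA smooth)
  show ?case
  proof (cases i)
    case 0
    have "k - j = Suc (k - Suc j)" using Suc.hyps(2) by simp
    then show ?thesis
      unfolding 0 phi_Ui_Ui_recursion(1)[of j] E
      by (simp only: add_0 sum.lessThan_Suc_shift) (simp add: DA_def fun_eq_iff sum_fun_apply sum_negf)
  next
    case (Suc l)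
    show ?thesis
    \<comment> \<open>If i + j \<ge> k, all sums involved are empty. Otherwise l + (j + 1) = i + j
      gives the sum for row l the same length, while the sum for (i, j + 1) is one shorter and is
      shifted up by E.\<close>
    proof (cases "k - (i + j)")
      case 0
      then show ?thesis unfolding Suc phi_Ui_Ui_recursion(2)[of l j] E IH by simp
    next
      case n: (Suc n)
      have 1: "\<phi> (Ui l) (Ui (Suc j)) = (\<Sum>m<Suc n. ?c l m * DA m (m + i + j + 1))"
        unfolding IH using n Suc by simp
      have 2: "apply_vf E (\<phi> (Ui i) (Ui (Suc j))) = (\<Sum>m<n. ?c i m * DA (Suc m) (Suc m + i + j + 1))"
      proof -
        have "k - Suc (i + j) = n" using n by simp
        then show ?thesis unfolding E by simp
      qed
      have "\<phi> (Ui i) (Ui j) = - apply_vf E (\<phi> (Ui i) (Ui (Suc j))) - \<phi> (Ui l) (Ui (Suc j))"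
        unfolding Suc by (rule phi_Ui_Ui_recursion(2))
      also have "\<dots> = (\<Sum>m<Suc n. ?c i m * DA m (m + i + j + 1))"
        unfolding 1 2 unfolding sum.lessThan_Suc_shift Suc
        by (simp add: fun_eq_iff sum_fun_apply sum_negf[symmetric] sum_subtractf[symmetric] sum.distrib[symmetric])
          (simp add: algebra_simps)
      finally show ?thesis unfolding n .
    qed
  qed
qed

text \<open>Off the diagonal the coefficients themselves vanish. On it they are merely real, and the
  two summands cancel by antisymmetry of the wedge product.\<close>

lemma D_part_eq_0: "D_part f k D = 0"
proof -
  have D: "D i j = 0" if "1 \<le> i" "i < j" "j \<le> k" for i j
  proof -
    have "Suc (i - 1) = i" "Suc (j - 1) = j" "i - 1 < j - 1" "j - 1 < k" using that by auto
    then show ?thesis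
      using phi_entries(2)[of "i - 1" "j - 1"] phi_Ui_Uibar[of "i - 1" "j - 1"] that by auto
  qed
  have Dii: "cnj_fun (D i i) = D i i" if "1 \<le> i" "i \<le> k" for i
    using phi_diagonal[of "i - 1"] phi_Ui_Uibar[of "i - 1" "i - 1"] that by simp
  have term0: "(D i j \<cdot> (eta f i \<and>\<^sub>f cnj_form (eta f j)) + (\<lambda>p. cnj (D i j p)) \<cdot> (cnj_form (eta f i) \<and>\<^sub>f eta f j)) as = 0"
    if ij: "1 \<le> i" "i \<le> j" "j \<le> k" for i j as
  proof (cases "i = j")
    case False
    then show ?thesis using D[of i j] ij by (auto simp: smult_form_def fun_eq_iff)
  next
    case True
    show ?thesis
    proof (cases "length as = 2")
      case True
      then obtain a b where "as = [a, b]" by (auto simp: numeral_2_eq_2 length_Suc_conv)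
      then show ?thesis
        using Dii[of i] ij \<open>i = j\<close>
        by (simp add: smult_form_apply wedge_apply has_degree_eta has_degree_cnj cnj_fun_def algebra_simps del: One_nat_def)
    next
      case False
      have "has_degree (1 + 1) (eta f i \<and>\<^sub>f cnj_form (eta f j))" "has_degree (1 + 1) (cnj_form (eta f i) \<and>\<^sub>f eta f j)"
        by (intro has_degree_wedge has_degree_eta has_degree_cnj)+
      then show ?thesis using False by (simp add: fun_eq_iff smult_form_def has_degree_def)
    qed
  qed
  show ?thesis
    unfolding D_part_def
  proof (rule sum.neutral, clarify)
    fix i j assume "1 \<le> i" "i \<le> j" "j \<le> k"
    then show "D i j \<cdot> (eta f i \<and>\<^sub>f cnj_form (eta f j)) + (\<lambda>p. cnj (D i j p)) \<cdot> (cnj_form (eta f i) \<and>\<^sub>f eta f j) = 0"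
      using term0[of i j] by (intro ext) simp
  qed
qed

text \<open>Both sides are compared in the coframe, where J is diagonal: h = - \<i> / 2 is - 1/2
  times its eigenvalue on the holomorphic part, and - h on the conjugate part. On \<eta>_0 both
  sides vanish, by the normalization of \<rho> and by A_u = 0.\<close>

lemma rho_eq: "\<rho> = (\<lambda>p. - 1 / 2) \<cdot> J f (ext_d (fun_form A))"
proof (intro ext)
  fix as p
  obtain n where n: "form_on n \<rho>" using normal by (auto simp: normal_form_def form_inf_def)
  define N where "N = max (Suc k) n"
  have N: "k < N" "k \<le> N" "n \<le> N" by (auto simp: N_def)
  let ?S = "coords_upto N"
  have coeff: "eval_form ?S \<rho> (frame f a) = (\<lambda>p. - 1 / 2 * J_eigenvalue a) * deriv_on ?S (frame f a) A"
    if "a \<in> ?S" for a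
    using that eval_rho_E[OF N(1)]
    by (cases a) (auto simp: eval_form_coord_vf deriv_on_coord_vf phi_U[symmetric] phi_U_Ui phi_U_Uibar
      rho_U_eq_0 partial_U_A h_def fun_eq_iff)
  have ap: "interior_prod (frame f a) (ext_d (fun_form A)) [] = deriv_on ?S (frame f a) A" for a
  proof -
    have "interior_prod (frame f a) (ext_d (fun_form A)) [] = apply_vf (frame f a) A"
      by (simp add: interior_prod_def apply_vf_def ext_d_fun_form fun_eq_iff)
    then show ?thesis
      using apply_vf_eq_deriv_on[OF smooth_fun_A, of ?S] coords_upto_mono[OF N(2)] by simp
  qed
  \<comment> \<open>Outside S the frame consists of coordinate fields, so the sum defining
    \<open>J\<close> reduces to S.\<close>
  have outside: "deriv_on ?S (frame f a) A = 0" if "a \<notin> ?S" for a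
  proof -
    have "frame f a = coord_vf a" using that by (cases a) auto
    moreover have "coord_vf a b = 0" if "b \<in> ?S" for b
      using that \<open>a \<notin> ?S\<close> by (auto simp: coord_vf_def fun_eq_iff)
    ultimately show ?thesis by (simp add: deriv_on_def)
  qed
  have "J f (ext_d (fun_form A)) as p = (\<Sum>a\<in>?S. J_eigenvalue a * deriv_on ?S (frame f a) A p * coframe f a as p)"
    unfolding J_def ap by (rule sum.mono_neutral_left) (auto, metis outside zero_fun_apply)
  moreover have "\<rho> as p = (\<Sum>a\<in>?S. - 1 / 2 * (J_eigenvalue a * deriv_on ?S (frame f a) A p * coframe f a as p))"
    unfolding coframe_expansion[OF n degree_rho N(3), of as f] sum_fun_apply
    by (intro sum.cong refl) (simp add: coeff)
  ultimately show "\<rho> as p = ((\<lambda>p. - 1 / 2) \<cdot> J f (ext_d (fun_form A))) as p"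
    by (simp only: smult_form_def sum_distrib_left)
qed

lemma B_eq:
  assumes "1 \<le> i" "i < j" "j \<le> k"
  shows "B i j p = \<i> * (\<Sum>m\<in>{m. int m \<le> int k - int j - int i + 1}.
      (-1) powi (int m - int i + 1) * of_nat ((m + i - 1) choose (i - 1)) *
      (apply_vf E ^^ m) (partial (Ui (m + j + i - 1)) A) p)"
proof -
  obtain a b where ab: "i = Suc a" "j = Suc b"
    using assms by (metis Suc_pred less_le_trans not_gr_zero not_less0 le_zero_eq zero_less_one)
  \<comment> \<open>The integer bound is negative exactly when i + j > k + 1; there truncated
    subtraction gives 0 and both sets are empty.\<close>
  have "{m. int m \<le> int k - int j - int i + 1} = {..<k - (a + b)}"
    using ab by auto
  \<comment> \<open>The exponent m - a may be negative, but it has the parity of m + a.\<close>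
  moreover have "(-1) powi (int m - int i + 1) = (-1 :: complex) ^ (m + a)" for m
  proof -
    have int_diff: "int m - int i + 1 = int m - int a" using ab by simp
    have "(-1) powi (int m - int i + 1) = (-1 :: complex) powi int m / (-1) powi int a"
      unfolding int_diff by (simp add: power_int_diff)
    then show ?thesis by (simp add: power_add uminus_power_if)
  qed
  moreover have "B i j = \<phi> (Ui a) (Ui b)"
    using phi_entries(1)[of a b] assms ab by simp
  ultimately show ?thesis
    unfolding phi_Ui_Ui ab by (simp add: sum_fun_apply DA_def sum_distrib_left algebra_simps)
qed

end

theorem proposition6p1:
  fixes f :: "real \<Rightarrow> real" and k :: nat and \<Phi> \<rho> :: form
    and A :: "point \<Rightarrow> complex" and B D :: "nat \<Rightarrow> nat \<Rightarrow> point \<Rightarrow> complex"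
  assumes "smooth_real f"
    and "\<forall>a b :: real. (\<forall>x. a * f x + b * deriv f x = 0) \<longrightarrow> a = 0 \<and> b = 0"
    and "\<Phi> \<in> cons_laws_on f k"
    and "normal_form f k \<Phi> \<rho> A B D"
    and "interior_prod (coord_vf U) \<rho> = 0"
  shows
   "(\<Phi> = eta f 0 \<and>\<^sub>f \<rho> + A \<cdot> psi f + B_part f k B) \<and>
    (\<rho> = (\<lambda>p. - 1 / 2) \<cdot> J f (ext_d (fun_form A))) \<and>
    (\<forall>i j. 1 \<le> i \<and> i < j \<and> j \<le> k \<longrightarrow>
           (\<forall>p. B i j p = \<i> * (\<Sum>m\<in>{m. int m \<le> int k - int j - int i + 1}.
              (-1) powi (int m - int i + 1) * of_nat ((m + i - 1) choose (i - 1)) *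
              (apply_vf (e_m1 f) ^^ m) (partial (Ui (m + j + i - 1)) A) p))) \<and>
    (smooth_fun k A) \<and>
    (\<forall>p. partial U A p = 0) \<and>
    (\<forall>i j p. partial (Uibar j) (partial (Ui i) A) p = 0) \<and>
    (\<forall>p. apply_vf (cnj_vf (e_m1 f)) (apply_vf (e_m1 f) A) p
             + of_real (deriv f (uval p)) * A p = 0)"
proof -
  interpret closed_normal_form f k \<Phi> \<rho> A B D
    using assms by unfold_locales (auto simp: cons_laws_on_def cons_laws_def)
  have "\<Phi> = eta f 0 \<and>\<^sub>f \<rho> + A \<cdot> psi f + B_part f k B"
    using normal D_part_eq_0 by (simp add: normal_form_def)
  then show ?thesis
    using rho_eq B_eq smooth_fun_A partial_U_A partial_Ui_Uibar_A determining_equation by simp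
qed

end
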